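(* Let $m\ge3$ and $J=(j_1,\dots,j_m)$ a tuple of positive integers. There is a bijection between the set of D-J classes of $\mathbb{Z}_2$-characteristic maps over $P_m(J)$ (equivalently, small covers over $P_m(J)$ up to D-J equivalence) and the set $DJ(m,J)$ of pairs $(\lambda,\mathcal E)$, where $\lambda$ is a D-J class over $P_m$ and $\mathcal E$ is a sequence $(1,S^1_1),\dots,(1,S^1_{j_1-1}),(2,S^2_1),\dots,(2,S^2_{j_2-1}),\dots,(m,S^m_1),\dots,(m,S^m_{j_m-1})$ of e-sets compatible with $\lambda$ that are pairwise $\lambda$-related.
   Context: $P_m$ is the simplicial complex on $[m]$ with facets $\{i,i+1\}$ mod $m$. For a simplicial complex $K$ on $[m]$ and $J\in\mathbb{Z}_{>0}^m$, $K(J)$ has vertex set $\{i_1,\dots,i_{j_i}: i\in[m]\}$ and minimal non-faces $\{(i_1)_1,\dots,(i_1)_{j_{i_1}},\dots,(i_k)_1,\dots,(i_k)_{j_{i_k}}\}$ for each minimal non-face $\{i_1,\dots,i_k\}$ of $K$. A $\mathbb{Z}_2$-characteristic map over an $(n-1)$-dimensional simplicial complex is a map from its vertices to $\mathbb{Z}_2^n$ sending the vertices of every face to linearly independent vectors; two are D-J equivalent if they differ by an element of $GL(n,\mathbb{Z}_2)$. A D-J class over $P_m$ is the same as an unordered weak partition $\lambda=\{\mu_{\mathbf a},\mu_{\mathbf b},\mu_{\mathbf c}\}$ of $[m]$ (parts possibly empty) into non-consecutive sets (no part contains $\{i,i+1 \bmod m\}$); $p,q$ are $\lambda$-equivalent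 if they lie in the same part. An e-set compatible with $\lambda$ is a pair $(p,S)$, $p\in[m]$, $S\subseteq[m]$ of even cardinality, with all elements of $\{p\}\cup S$ mutually $\lambda$-equivalent. For nonempty such $S$, the points of $S$ cut the cycle $[m]$ into $|S|$ nonempty arcs (maximal cyclic intervals of $[m]\setminus S$), colored alternately black/white; for $r\notin S$, $\Omega_r(S)=A\cup S$ where $A$ is the union of black arcs for the coloring in which the arc containing $r$ is white. Two e-sets $(p,S),(q,T)$ compatible with $\lambda$ are $\lambda$-related if either $S=\varnothing$ or $T=\varnothing$ or $p,q$ are $\lambda$-equivalent (type 1), or $S,T\ne\varnothing$, $p,q$ are not $\lambda$-equivalent, and $\Omega_q(S)\cap\Omega_p(T)=\varnothing$ (type 2). *)

theory Defs
  imports Main "HOL-Library.Z2"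
begin

(* Vertices of the cycle P_m are 0,...,m-1 (standing for [m] = 1..m), arithmetic mod m. *)

definition faces_P :: "nat \<Rightarrow> nat set set" where
  "faces_P m = {\<sigma>. \<sigma> \<subseteq> {0..<m} \<and>
      (card \<sigma> \<le> 1 \<or> (\<exists>i<m. \<sigma> = {i, Suc i mod m}))}"

definition min_nonfaces :: "'v set \<Rightarrow> 'v set set \<Rightarrow> 'v set set" where
  "min_nonfaces V K = {\<tau>. \<tau> \<subseteq> V \<and> \<tau> \<notin> K \<and> (\<forall>x\<in>\<tau>. \<tau> - {x} \<in> K)}"

(* vertex set of K(J): vertex i is replaced by (i,0),...,(i,J i - 1) *)
definition verts_J :: "nat \<Rightarrow> (nat \<Rightarrow> nat) \<Rightarrow> (nat \<times> nat) set" where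
  "verts_J m J = {(i,k). i < m \<and> k < J i}"

definition blowup :: "(nat \<Rightarrow> nat) \<Rightarrow> nat set \<Rightarrow> (nat \<times> nat) set" where
  "blowup J \<tau> = {(i,k). i \<in> \<tau> \<and> k < J i}"

(* P_m(J): the simplicial complex on verts_J m J whose minimal non-faces are the
   blow-ups of the minimal non-faces of P_m *)
definition faces_PJ :: "nat \<Rightarrow> (nat \<Rightarrow> nat) \<Rightarrow> (nat \<times> nat) set set" where
  "faces_PJ m J = {\<sigma>. \<sigma> \<subseteq> verts_J m J \<and>
      (\<forall>\<tau>\<in>min_nonfaces {0..<m} (faces_P m). \<not> blowup J \<tau> \<subseteq> \<sigma>)}"

definition dimp1 :: "'v set set \<Rightarrow> nat" where
  "dimp1 K = Max (card ` K)"

(* a vector of Z_2^n is a function nat => bit vanishing at indices >= n *)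
definition char_maps :: "'v set \<Rightarrow> 'v set set \<Rightarrow> nat \<Rightarrow> ('v \<Rightarrow> nat \<Rightarrow> bit) set" where
  "char_maps V K n = {chi.
      (\<forall>v. \<forall>i. (v \<notin> V \<or> n \<le> i) \<longrightarrow> chi v i = 0) \<and>
      (\<forall>\<sigma>\<in>K. \<forall>c :: 'v \<Rightarrow> bit.
          (\<forall>i. (\<Sum>v\<in>\<sigma>. c v * chi v i) = 0) \<longrightarrow> (\<forall>v\<in>\<sigma>. c v = 0))}"

definition invertible_Z2 :: "nat \<Rightarrow> (nat \<Rightarrow> nat \<Rightarrow> bit) \<Rightarrow> bool" where
  "invertible_Z2 n A \<longleftrightarrow> (\<exists>B. \<forall>i<n. \<forall>j<n.
      (\<Sum>k<n. A i k * B k j) = (if i = j then 1 else 0) \<and>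
      (\<Sum>k<n. B i k * A k j) = (if i = j then 1 else 0))"

definition DJ_rel :: "'v set \<Rightarrow> 'v set set \<Rightarrow> nat \<Rightarrow> (('v \<Rightarrow> nat \<Rightarrow> bit) \<times> ('v \<Rightarrow> nat \<Rightarrow> bit)) set" where
  "DJ_rel V K n = {(chi, chi'). chi \<in> char_maps V K n \<and> chi' \<in> char_maps V K n \<and>
      (\<exists>A. invertible_Z2 n A \<and> (\<forall>v\<in>V. \<forall>i<n. chi' v i = (\<Sum>k<n. A i k * chi v k)))}"

definition DJ_classes_PJ :: "nat \<Rightarrow> (nat \<Rightarrow> nat) \<Rightarrow> ((nat \<times> nat) \<Rightarrow> nat \<Rightarrow> bit) set set" where
  "DJ_classes_PJ m J =
     (let V = verts_J m J; K = faces_PJ m J; n = dimp1 K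
      in char_maps V K n // DJ_rel V K n)"

section \<open>D-J classes over P_m as weak partitions\<close>

definition nonconsec :: "nat \<Rightarrow> nat set \<Rightarrow> bool" where
  "nonconsec m A \<longleftrightarrow> (\<forall>i<m. \<not> {i, Suc i mod m} \<subseteq> A)"

definition DJ_P :: "nat \<Rightarrow> nat set set set" where
  "DJ_P m = {\<Lambda>. card \<Lambda> = 3 \<and> \<Union>\<Lambda> = {0..<m} \<and>
      (\<forall>A\<in>\<Lambda>. \<forall>B\<in>\<Lambda>. A \<noteq> B \<longrightarrow> A \<inter> B = {}) \<and> (\<forall>A\<in>\<Lambda>. nonconsec m A)}"

definition lam_equiv :: "nat set set \<Rightarrow> nat \<Rightarrow> nat \<Rightarrow> bool" where
  "lam_equiv \<Lambda> p q \<longleftrightarrow> (\<exists>A\<in>\<Lambda>. p \<in> A \<and> q \<in> A)"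

definition eset_compat :: "nat \<Rightarrow> nat set set \<Rightarrow> nat \<Rightarrow> nat set \<Rightarrow> bool" where
  "eset_compat m \<Lambda> p S \<longleftrightarrow> p < m \<and> S \<subseteq> {0..<m} \<and> even (card S) \<and>
      (\<forall>x\<in>insert p S. \<forall>y\<in>insert p S. lam_equiv \<Lambda> x y)"

definition cyc_interval :: "nat \<Rightarrow> nat \<Rightarrow> nat \<Rightarrow> nat set" where
  "cyc_interval m a l = {(a + t) mod m | t. t < l}"

definition arc_cands :: "nat \<Rightarrow> nat set \<Rightarrow> nat set set" where
  "arc_cands m S = {I. I \<noteq> {} \<and> I \<subseteq> {0..<m} - S \<and> (\<exists>a<m. \<exists>l. I = cyc_interval m a l)}"

definition arcs :: "nat \<Rightarrow> nat set \<Rightarrow> nat set set" where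
  "arcs m S = {I \<in> arc_cands m S. \<forall>I'\<in>arc_cands m S. I \<subseteq> I' \<longrightarrow> I' = I}"

definition arc_of :: "nat \<Rightarrow> nat set \<Rightarrow> nat \<Rightarrow> nat set" where
  "arc_of m S x = (THE I. I \<in> arcs m S \<and> x \<in> I)"

definition arcs_adjacent :: "nat \<Rightarrow> nat set \<Rightarrow> nat set \<Rightarrow> nat set \<Rightarrow> bool" where
  "arcs_adjacent m S I I' \<longleftrightarrow> (\<exists>s\<in>S. (s + m - 1) mod m \<in> I \<and> Suc s mod m \<in> I')"

definition alternating :: "nat \<Rightarrow> nat set \<Rightarrow> (nat set \<Rightarrow> bool) \<Rightarrow> bool" where
  "alternating m S col \<longleftrightarrow> (\<forall>I\<in>arcs m S. \<forall>I'\<in>arcs m S.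
      arcs_adjacent m S I I' \<longrightarrow> col I \<noteq> col I')"

(* Omega_r(S) = S union the black arcs, where the arc containing r is white *)
definition Omega :: "nat \<Rightarrow> nat \<Rightarrow> nat set \<Rightarrow> nat set" where
  "Omega m r S = S \<union> \<Union>{I \<in> arcs m S. \<exists>col. alternating m S col \<and> col I \<noteq> col (arc_of m S r)}"

definition lam_related :: "nat \<Rightarrow> nat set set \<Rightarrow> nat \<times> nat set \<Rightarrow> nat \<times> nat set \<Rightarrow> bool" where
  "lam_related m \<Lambda> e1 e2 \<longleftrightarrow> (case (e1, e2) of ((p, S), (q, T)) \<Rightarrow>
      (S = {} \<or> T = {} \<or> lam_equiv \<Lambda> p q) \<or>
      (S \<noteq> {} \<and> T \<noteq> {} \<and> \<not> lam_equiv \<Lambda> p q \<and> Omega m q S \<inter> Omega m p T = {}))"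

(* positions of the sequence E: (i,k) stands for (i, S^i_{k+1}), i < m, k < J i - 1 *)
definition E_index :: "nat \<Rightarrow> (nat \<Rightarrow> nat) \<Rightarrow> (nat \<times> nat) set" where
  "E_index m J = {(i,k). i < m \<and> k < J i - 1}"

definition DJ_mJ :: "nat \<Rightarrow> (nat \<Rightarrow> nat) \<Rightarrow> (nat set set \<times> (nat \<times> nat \<Rightarrow> nat set)) set" where
  "DJ_mJ m J = {(\<Lambda>, E). \<Lambda> \<in> DJ_P m \<and>
      (\<forall>x. x \<notin> E_index m J \<longrightarrow> E x = {}) \<and>
      (\<forall>x\<in>E_index m J. eset_compat m \<Lambda> (fst x) (E x)) \<and>
      (\<forall>x\<in>E_index m J. \<forall>y\<in>E_index m J. x \<noteq> y \<longrightarrow>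
          lam_related m \<Lambda> (fst x, E x) (fst y, E y))}"

end

theory Submission
  imports Defs
begin

text \<open>Two characteristic maps are D-J equivalent if and only if their linear relations form the same
  subspace of \<open>\<int>\<^sub>2\<^sup>V\<close>, and a subspace of the right dimension arises in this way if and only if no
  nonzero vector in it is supported on a face. Restricting such a subspace to the vertices
  \<open>(i, 0)\<close> gives the relations of a characteristic map over \<open>P_m\<close>, that is, a partition \<open>\<lambda>\<close>.
  Every further vertex \<open>(p, k + 1)\<close> adds one linear functional; the faces meeting a single
  such vertex force it to be \<open>c (p, 0)\<close> plus the sum of \<open>c (l, 0)\<close> over those \<open>l\<close> outside the part of
  \<open>p\<close> that lie in alternate arcs cut out by an even subset \<open>S\<close> of that part: an e-set. Two e-sets
  are \<open>\<lambda>\<close>-related exactly if no face condition involving only the two of them fails. That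
  pairwise conditions suffice for all faces is a triangularity argument: relative to a fixed edge
  \<open>{i, i + 1}\<close>, a nonzero coefficient at \<open>q\<close> in the functional of \<open>p\<close> makes the region cut off from
  the edge at \<open>q\<close> strictly smaller than the region cut off at \<open>p\<close>.\<close>

text \<open>The hinge is that the gap between \<open>i\<close> and \<open>i + 1\<close> is the same
  thing as the edge \<open>{i, i + 1}\<close> of the polygon. A face of the blow-up contains
  complete fibres only over the two ends of one edge, so each face condition is tested at one gap;
  and two \<open>Omega\<close> sets that meet already share a gap. Cuts are therefore recorded by a
  parity \<open>side S (Suc i)\<close> attached to gaps instead of by maximal arcs and colourings.
  Counting from vertex \<open>0\<close> makes this parity depend on a base point, just as black and
  white may be exchanged. On relations of the polygon the choice is immaterial: flipping all colours
  changes the functional of \<open>p\<close> by the sum of the coefficients outside the part of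
  \<open>p\<close>, which is zero. So the colouring can be normalised to vanish at the gap under
  study, and both ends of that edge then drop out of the functional. Passing to kernels removes
  \<open>GL\<close> altogether: no matrix has to be put into a normal form, and a characteristic map
  with a given kernel is obtained by writing the defining equations of the kernel as its
  rows.\<close>

declare add_bit_eq_xor [simp del] mult_bit_eq_and [simp del]

lemma bit_double [simp]: "(a::bit) + a = 0"
  by (cases a) simp_all

lemma bit_add_eq_0_iff [simp]: "(a::bit) + b = 0 \<longleftrightarrow> a = b"
  by (cases a; cases b) simp_all

lemma bit_add_eq_1_iff [simp]: "(a::bit) + b = 1 \<longleftrightarrow> a \<noteq> b"
  by (cases a; cases b) simp_all

lemma bit_neq_trans: "(a::bit) \<noteq> b \<Longrightarrow> b \<noteq> c \<Longrightarrow> a = c"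
  by (cases a; cases b; cases c) simp_all

section \<open>Parity of cut points and the sets Omega\<close>

text \<open>The parity of the number of cut points before \<open>l\<close>. The value at
  \<open>Suc i\<close> belongs to the gap between \<open>i\<close> and \<open>i + 1\<close>; at a
  cut point \<open>s\<close> the value \<open>side S s\<close> is, up to wrap-around, that of the
  gap before \<open>s\<close>.\<close>

definition side :: "nat set \<Rightarrow> nat \<Rightarrow> bit" where
  "side S l = (\<Sum>s<l. of_bool (s \<in> S))"

lemma side_0 [simp]: "side S 0 = 0"
  by (simp add: side_def)

lemma side_Suc: "side S (Suc l) = side S l + of_bool (l \<in> S)"
  by (simp add: side_def)

lemma side_Suc_notin [simp]: "l \<notin> S \<Longrightarrow> side S (Suc l) = side S l"
  by (simp add: side_Suc)

lemma side_Suc_in: "l \<in> S \<Longrightarrow> side S (Suc l) \<noteq> side S l"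
  by (cases "side S l") (simp_all add: side_Suc)

lemma side_empty [simp]: "side {} l = 0"
  by (simp add: side_def)

lemma side_full:
  assumes "S \<subseteq> {0..<m}"
  shows "side S m = 0 \<longleftrightarrow> even (card S)"
proof -
  have "side S m = (\<Sum>s\<in>S. 1)"
    unfolding side_def
    by (rule sum.mono_neutral_cong_right) (use assms in auto)
  then have "side S m = of_nat (card S)" by simp
  moreover have "(of_nat k :: bit) = 0 \<longleftrightarrow> even k" for k
    by (induction k) auto
  ultimately show ?thesis by simp
qed

text \<open>Evenness makes the parity close up around the cycle: the gap after \<open>m - 1\<close>
  has value \<open>0\<close>, the value at vertex \<open>0\<close>.\<close>

lemma side_Suc_mod:
  assumes "side S m = 0" "i < m"
  shows "side S (Suc i mod m) = side S (Suc i)"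
  using assms by (cases "Suc i = m") simp_all

lemma ex_cyclic_pred:
  assumes "i < m"
  obtains j where "j < m" "Suc j mod m = i" "(i + m - 1) mod m = j"
proof (cases i)
  case 0
  with assms that[of "m - 1"] show ?thesis by simp
next
  case (Suc j)
  with assms have "(i + m - 1) mod m = j" by simp
  with Suc assms that[of j] show ?thesis by simp
qed

section \<open>Maximal arcs of the cut cycle\<close>

lemma finite_arc_cands: "finite (arc_cands m S)"
  by (rule finite_subset[of _ "Pow {0..<m}"]) (auto simp: arc_cands_def)

text \<open>Whichever interval reaches the common point in fewer steps starts inside the other one,
  so the union starts where the other one starts. Lengths above \<open>m\<close> are allowed in
  \<open>cyc_interval\<close>, which removes a case distinction on wrapping around.\<close>

lemma cyc_interval_union:
  assumes "x \<in> cyc_interval m a l" "x \<in> cyc_interval m b k" "a < m" "b < m"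
  shows "\<exists>c<m. \<exists>h. cyc_interval m a l \<union> cyc_interval m b k = cyc_interval m c h"
proof -
  have overlap: "\<exists>h. cyc_interval m a l \<union> cyc_interval m b k = cyc_interval m b h"
    if "(a + t) mod m = (b + u) mod m" "t < l" "u < k" "t \<le> u" "a < m" "b < m" for a b l k t u
  proof -
    define d where "d = u - t"
    have "(b + d + t) mod m = (a + t) mod m"
      using that by (simp add: d_def)
    then have ad: "a = (b + d) mod m"
    proof -
      from \<open>(b + d + t) mod m = (a + t) mod m\<close>
      obtain q r where "b + d + t + m * q = a + t + m * r"
        by (auto simp: nat_mod_eq_iff)
      then have "b + d + m * q = a + m * r" by simp
      then have "(b + d) mod m = a mod m" by (auto simp: nat_mod_eq_iff)
      with that(5) show ?thesis by simp
    qed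
    have "cyc_interval m a l = {(b + v) mod m | v. d \<le> v \<and> v < d + l}"
      unfolding cyc_interval_def ad mod_add_left_eq
    proof (intro set_eqI iffI; clarsimp)
      fix t assume "t < l"
      then show "\<exists>v. (b + d + t) mod m = (b + v) mod m \<and> d \<le> v \<and> v < d + l"
        by (intro exI[of _ "d + t"]) (simp add: add.assoc)
    next
      fix v assume "d \<le> v" "v < d + l"
      then show "\<exists>t. (b + v) mod m = (b + d + t) mod m \<and> t < l"
        by (intro exI[of _ "v - d"]) auto
    qed
    moreover have "d < k" using that(3,4) by (simp add: d_def)
    then have "v < max k (d + l) \<longleftrightarrow> v < k \<or> d \<le> v \<and> v < d + l" for v
      by linarith
    ultimately have "cyc_interval m a l \<union> cyc_interval m b k = cyc_interval m b (max k (d + l))"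
      unfolding cyc_interval_def by blast
    then show ?thesis ..
  qed
  from assms(1) obtain t where "x = (a + t) mod m" "t < l"
    by (auto simp: cyc_interval_def)
  moreover from assms(2) obtain u where "x = (b + u) mod m" "u < k"
    by (auto simp: cyc_interval_def)
  ultimately show ?thesis
    using overlap[of a t b u l k] overlap[of b u a t k l] assms(3,4)
    by (cases "t \<le> u") (simp_all add: Un_commute, blast+)
qed

lemma arc_cands_union:
  assumes "I \<in> arc_cands m S" "I' \<in> arc_cands m S" "x \<in> I" "x \<in> I'"
  shows "I \<union> I' \<in> arc_cands m S"
proof -
  from assms obtain a l b k where "a < m" "b < m" "I = cyc_interval m a l" "I' = cyc_interval m b k"
    by (auto simp: arc_cands_def)
  with cyc_interval_union[of x m a l b k] assms show ?thesis
    unfolding arc_cands_def by auto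
qed

lemma cand_subset_arc:
  assumes "I \<in> arcs m S" "I' \<in> arc_cands m S" "x \<in> I" "x \<in> I'"
  shows "I' \<subseteq> I"
proof -
  have "I \<union> I' \<in> arc_cands m S"
    using assms by (intro arc_cands_union[of _ _ _ _ x]) (auto simp: arcs_def)
  with assms(1) have "I \<union> I' = I"
    by (auto simp: arcs_def)
  then show ?thesis by auto
qed

lemma singleton_cand:
  assumes "x < m" "x \<notin> S"
  shows "{x} \<in> arc_cands m S"
proof -
  have "{x} = cyc_interval m x 1"
    using assms(1) by (auto simp: cyc_interval_def)
  with assms show ?thesis
    by (auto simp: arc_cands_def)
qed

lemma pair_cand:
  assumes "x < m" "x \<notin> S" "Suc x mod m \<notin> S"
  shows "{x, Suc x mod m} \<in> arc_cands m S"
proof -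
  have "{x, Suc x mod m} = cyc_interval m x 2"
    using assms(1) by (auto simp: cyc_interval_def less_2_cases_iff intro: exI[of _ 0] exI[of _ 1])
  with assms show ?thesis
    by (auto simp: arc_cands_def)
qed

lemma ex1_arc:
  assumes "x < m" "x \<notin> S"
  shows "\<exists>!I. I \<in> arcs m S \<and> x \<in> I"
proof -
  from finite_has_maximal2[OF finite_arc_cands singleton_cand[OF assms]]
  obtain I where "I \<in> arc_cands m S" "{x} \<subseteq> I"
      "\<forall>I'\<in>arc_cands m S. I \<subseteq> I' \<longrightarrow> I = I'" by blast
  then have "I \<in> arcs m S \<and> x \<in> I" by (auto simp: arcs_def)
  moreover have "A = B" if "A \<in> arcs m S \<and> x \<in> A" "B \<in> arcs m S \<and> x \<in> B" for A B
    using that cand_subset_arc[of A m S B x] cand_subset_arc[of B m S A x]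
    by (auto simp: arcs_def)
  ultimately show ?thesis by blast
qed

lemma arc_of:
  assumes "x < m" "x \<notin> S"
  shows "arc_of m S x \<in> arcs m S" "x \<in> arc_of m S x"
  using theI'[OF ex1_arc[OF assms]] by (auto simp: arc_of_def)

lemma arc_of_eq:
  assumes "I \<in> arcs m S" "x \<in> I"
  shows "arc_of m S x = I"
proof -
  have "x < m" "x \<notin> S"
    using assms by (auto simp: arcs_def arc_cands_def)
  from ex1_arc[OF this] arc_of[OF this] assms show ?thesis by blast
qed

lemma arc_of_Suc:
  assumes "x < m" "x \<notin> S" "Suc x mod m \<notin> S"
  shows "arc_of m S (Suc x mod m) = arc_of m S x"
proof -
  have "{x, Suc x mod m} \<subseteq> arc_of m S x"
    by (rule cand_subset_arc[of _ m S _ x]) (use assms arc_of pair_cand in auto)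
  then show ?thesis
    using arc_of_eq arc_of(1) assms(1,2) by auto
qed

lemma side_const_on_arc:
  assumes "side S m = 0" "I \<in> arcs m S" "x \<in> I" "y \<in> I"
  shows "side S x = side S y"
proof -
  from assms(2) obtain a l where I: "I = cyc_interval m a l" "a < m" "I \<inter> S = {}"
    by (auto simp: arcs_def arc_cands_def)
  have "side S ((a + t) mod m) = side S a" if "t < l" for t
    using that
  proof (induction t)
    case (Suc t)
    have "(a + t) mod m \<in> I" using Suc.prems by (auto simp: I cyc_interval_def)
    then have "(a + t) mod m \<notin> S" using I by auto
    then have "side S (Suc ((a + t) mod m)) = side S a" using Suc by simp
    moreover have "(a + Suc t) mod m = Suc ((a + t) mod m) mod m"
      by (simp add: mod_Suc_eq)
    ultimately show ?case
      using side_Suc_mod[OF assms(1), of "(a + t) mod m"] I(2) by simp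
  qed (use I in simp)
  then show ?thesis
    using assms(3,4) by (auto simp: I cyc_interval_def)
qed

lemma bex_eq_const_iff:
  assumes "\<And>y. y \<in> I \<Longrightarrow> f y = f j" "j \<in> I"
  shows "(\<exists>y\<in>I. f y = c) \<longleftrightarrow> f j = c"
  using assms by metis

text \<open>Crossing a cut point flips the parity. Since no two cut points are adjacent, the vertex
  before a cut point lies on an arc, and the parity at the cut point is the one of that arc.\<close>

lemma alternating_side:
  assumes "side S m = 0" "nonconsec m S" "S \<subseteq> {0..<m}"
  shows "alternating m S (\<lambda>I. \<exists>y\<in>I. side S y = 1)"
  unfolding alternating_def
proof (intro ballI impI)
  fix I I' assume I: "I \<in> arcs m S" "I' \<in> arcs m S" "arcs_adjacent m S I I'"
  then obtain s where s: "s \<in> S" "(s + m - 1) mod m \<in> I" "Suc s mod m \<in> I'"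
    by (auto simp: arcs_adjacent_def)
  with assms(3) have "s < m" by auto
  then obtain j where j: "j < m" "Suc j mod m = s" "(s + m - 1) mod m = j"
    by (rule ex_cyclic_pred)
  have "j \<notin> S"
    using assms(2) j(1,2) s(1) by (auto simp: nonconsec_def)
  then have "side S s = side S j"
    using side_Suc_mod[OF assms(1) j(1)] j(2) by simp
  moreover have "side S (Suc s mod m) \<noteq> side S s"
    using side_Suc_mod[OF assms(1) \<open>s < m\<close>] side_Suc_in[OF s(1)] by simp
  ultimately have "side S (Suc s mod m) \<noteq> side S j" by simp
  moreover have "j \<in> I" using s(2) j(3) by simp
  then have "(\<exists>y\<in>I. side S y = 1) \<longleftrightarrow> side S j = 1"
    using side_const_on_arc[OF assms(1) I(1) _ \<open>j \<in> I\<close>] by (intro bex_eq_const_iff)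
  moreover have "(\<exists>y\<in>I'. side S y = 1) \<longleftrightarrow> side S (Suc s mod m) = 1"
    using side_const_on_arc[OF assms(1) I(2) _ s(3)] s(3) by (intro bex_eq_const_iff)
  ultimately show "(\<exists>y\<in>I. side S y = 1) \<noteq> (\<exists>y\<in>I'. side S y = 1)"
    by (cases "side S j"; cases "side S (Suc s mod m)") simp_all
qed

text \<open>Alternating colourings are unique up to exchanging the colours. Walking back from
  \<open>y\<close>, one step either stays in the arc or meets a cut point; in the second case a
  further step lands outside \<open>S\<close>, and both the colour and the parity have flipped
  once.\<close>

lemma alternating_eq_side_le:
  assumes "alternating m S col" "nonconsec m S" "x \<le> y" "y < m" "x \<notin> S" "y \<notin> S"
  shows "col (arc_of m S x) = col (arc_of m S y) \<longleftrightarrow> side S x = side S y"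
  using assms(3,4,6)
proof (induction y rule: less_induct)
  case (less y)
  show ?case
  proof (cases "x = y")
    case False
    with less.prems obtain z where z: "y = Suc z" "x \<le> z"
      by (cases y) auto
    show ?thesis
    proof (cases "z \<in> S")
      case False
      then have "arc_of m S y = arc_of m S z" "side S y = side S z"
        using arc_of_Suc[of z m S] z less.prems by auto
      with less.IH[of z] z less.prems False show ?thesis by simp
    next
      case True
      with \<open>x \<notin> S\<close> z obtain w where w: "z = Suc w" "x \<le> w"
        by (cases z) (auto simp: le_Suc_eq)
      have "w < m" "Suc w mod m = Suc w" using less.prems z w by simp_all
      with assms(2) True w have wS: "w \<notin> S"
        unfolding nonconsec_def by auto
      have "arcs_adjacent m S (arc_of m S w) (arc_of m S y)"
        unfolding arcs_adjacent_def
      proof (rule bexI[of _ z], intro conjI)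
        show "(z + m - 1) mod m \<in> arc_of m S w"
          using arc_of(2)[OF \<open>w < m\<close> wS] w \<open>w < m\<close> by simp
        show "Suc z mod m \<in> arc_of m S y"
          using arc_of(2)[of y m S] z less.prems by simp
      qed fact
      then have "col (arc_of m S w) \<noteq> col (arc_of m S y)"
        using assms(1) arc_of(1)[OF \<open>w < m\<close> wS] arc_of(1)[of y m S] less.prems
        unfolding alternating_def by blast
      moreover have "side S y \<noteq> side S w"
        using side_Suc_in[OF True] wS w z by simp
      moreover have "col (arc_of m S x) = col (arc_of m S w) \<longleftrightarrow> side S x = side S w"
        using less.IH[of w] less.prems w z wS by simp
      ultimately show ?thesis
        using bit_neq_trans[of "side S y" "side S w" "side S x"] by auto
    qed
  qed simp
qed

lemma alternating_eq_side:
  assumes "alternating m S col" "nonconsec m S" "x < m" "y < m" "x \<notin> S" "y \<notin> S"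
  shows "col (arc_of m S x) = col (arc_of m S y) \<longleftrightarrow> side S x = side S y"
proof (cases "x \<le> y")
  case True
  then show ?thesis by (rule alternating_eq_side_le[OF assms(1,2) _ assms(4-6)])
next
  case False
  then have "y \<le> x" by simp
  from alternating_eq_side_le[OF assms(1,2) this assms(3,6,5)] show ?thesis by metis
qed

text \<open>The existential over colourings in \<open>Omega\<close> is harmless: the comparison with
  the arc of \<open>r\<close> is unaffected by exchanging colours, so the parity colouring decides
  it.\<close>

lemma Omega_eq:
  assumes "even (card S)" "nonconsec m S" "S \<subseteq> {0..<m}" "r < m" "r \<notin> S"
  shows "Omega m r S = S \<union> {x. x < m \<and> x \<notin> S \<and> side S x \<noteq> side S r}"
proof -
  let ?col = "\<lambda>I. \<exists>y\<in>I. side S y = 1"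
  have s0: "side S m = 0" using side_full assms by simp
  have alt: "alternating m S ?col"
    by (rule alternating_side[OF s0 assms(2,3)])
  have "\<Union>{I \<in> arcs m S. \<exists>col. alternating m S col \<and> col I \<noteq> col (arc_of m S r)}
      = {x. x < m \<and> x \<notin> S \<and> side S x \<noteq> side S r}" (is "?L = ?R")
  proof (intro equalityI subsetI)
    fix x assume "x \<in> ?L"
    then obtain I col where I: "I \<in> arcs m S" "x \<in> I" "alternating m S col"
        "col I \<noteq> col (arc_of m S r)" by blast
    then have "x < m" "x \<notin> S" by (auto simp: arcs_def arc_cands_def)
    with I arc_of_eq[OF I(1,2)] alternating_eq_side[of m S col x r] assms show "x \<in> ?R"
      by simp
  next
    fix x assume "x \<in> ?R"
    then have x: "x < m" "x \<notin> S" "side S x \<noteq> side S r" by auto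
    then have "?col (arc_of m S x) \<noteq> ?col (arc_of m S r)"
      using alternating_eq_side[OF alt assms(2), of x r] assms by blast
    with alt arc_of[OF x(1,2)] show "x \<in> ?L" by blast
  qed
  then show ?thesis
    unfolding Omega_def by simp
qed

section \<open>Weak partitions and related e-sets\<close>

lemma lam_equiv_sym: "lam_equiv \<Lambda> p q \<Longrightarrow> lam_equiv \<Lambda> q p"
  by (auto simp: lam_equiv_def)

lemma lam_equiv_commute: "lam_equiv \<Lambda> p q \<longleftrightarrow> lam_equiv \<Lambda> q p"
  by (auto simp: lam_equiv_def)

lemma DJ_P_part:
  assumes "\<Lambda> \<in> DJ_P m" "p < m"
  obtains A where "A \<in> \<Lambda>" "p \<in> A"
proof -
  have "p \<in> \<Union>\<Lambda>" using assms by (simp add: DJ_P_def)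
  then show ?thesis using that by blast
qed

lemma DJ_P_disjoint:
  assumes "\<Lambda> \<in> DJ_P m" "A \<in> \<Lambda>" "B \<in> \<Lambda>" "p \<in> A" "p \<in> B"
  shows "A = B"
proof -
  have "\<forall>A\<in>\<Lambda>. \<forall>B\<in>\<Lambda>. A \<noteq> B \<longrightarrow> A \<inter> B = {}" using assms(1) by (simp add: DJ_P_def)
  with assms(2-) show ?thesis by blast
qed

lemma lam_equiv_part:
  assumes "\<Lambda> \<in> DJ_P m" "A \<in> \<Lambda>" "p \<in> A"
  shows "lam_equiv \<Lambda> p q \<longleftrightarrow> q \<in> A"
  using DJ_P_disjoint[OF assms(1)] assms(2,3) unfolding lam_equiv_def by blast

lemma lam_equiv_refl:
  assumes "\<Lambda> \<in> DJ_P m" "p < m"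
  shows "lam_equiv \<Lambda> p p"
  using DJ_P_part[OF assms] by (auto simp: lam_equiv_def)

lemma lam_equiv_trans:
  assumes "\<Lambda> \<in> DJ_P m" "lam_equiv \<Lambda> p q" "lam_equiv \<Lambda> q r"
  shows "lam_equiv \<Lambda> p r"
  using DJ_P_disjoint[OF assms(1)] assms(2,3) unfolding lam_equiv_def by blast

lemma not_lam_equiv_Suc:
  assumes "\<Lambda> \<in> DJ_P m" "i < m"
  shows "\<not> lam_equiv \<Lambda> i (Suc i mod m)"
proof -
  have "nonconsec m A" if "A \<in> \<Lambda>" for A using assms(1) that by (simp add: DJ_P_def)
  with assms(2) show ?thesis by (auto simp: lam_equiv_def nonconsec_def)
qed

lemma DJ_P_subset: "\<Lambda> \<in> DJ_P m \<Longrightarrow> A \<in> \<Lambda> \<Longrightarrow> A \<subseteq> {..<m}"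
  unfolding DJ_P_def by (auto simp: atLeast0LessThan)

lemma eset_empty: "\<Lambda> \<in> DJ_P m \<Longrightarrow> p < m \<Longrightarrow> eset_compat m \<Lambda> p {}"
  by (simp add: eset_compat_def lam_equiv_refl)

lemma eset_equiv: "eset_compat m \<Lambda> p S \<Longrightarrow> s \<in> S \<Longrightarrow> lam_equiv \<Lambda> p s"
  by (simp add: eset_compat_def)

lemma eset_notin:
  assumes "eset_compat m \<Lambda> p S" "\<not> lam_equiv \<Lambda> p q"
  shows "q \<notin> S"
  using assms eset_equiv by blast

lemma eset_side: "eset_compat m \<Lambda> p S \<Longrightarrow> side S m = 0"
  by (simp add: eset_compat_def side_full)

lemma eset_nonconsec:
  assumes "\<Lambda> \<in> DJ_P m" "eset_compat m \<Lambda> p S"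
  shows "nonconsec m S"
  unfolding nonconsec_def
proof (intro allI impI notI)
  fix i assume "i < m" "{i, Suc i mod m} \<subseteq> S"
  then have "lam_equiv \<Lambda> i (Suc i mod m)"
    using assms(2) by (simp add: eset_compat_def)
  with not_lam_equiv_Suc[OF assms(1) \<open>i < m\<close>] show False by simp
qed

lemma Omega_eset:
  assumes "\<Lambda> \<in> DJ_P m" "eset_compat m \<Lambda> p S" "\<not> lam_equiv \<Lambda> p r" "r < m"
  shows "Omega m r S = S \<union> {x. x < m \<and> x \<notin> S \<and> side S x \<noteq> side S r}"
  by (rule Omega_eq)
    (use assms eset_nonconsec[OF assms(1,2)] eset_notin[OF assms(2,3)] in
      \<open>auto simp: eset_compat_def\<close>)

text \<open>The gap preceding \<open>s\<close>, with wrap-around at \<open>0\<close>. It is chosen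
  before \<open>S\<close> is quantified, so that two e-sets can be compared at one and the same
  gap.\<close>

lemma ex_gap_before:
  assumes "s < m" "0 < m"
  obtains j where "j < m" "\<And>S. side S m = 0 \<Longrightarrow> side S (Suc j) = side S s"
proof -
  from ex_cyclic_pred[OF assms(1)] obtain j where "j < m" "Suc j mod m = s" by blast
  then show ?thesis
    using that[of j] side_Suc_mod[of _ m j] by metis
qed

text \<open>The gap between \<open>i\<close> and \<open>i + 1\<close> lies on the side \<open>side S (Suc i)\<close> of the cut along \<open>S\<close>.
  Both \<open>\<Omega>\<close> sets are unions of closed arcs, so they meet if and only if they share a gap.\<close>

lemma lam_related_iff:
  assumes L: "\<Lambda> \<in> DJ_P m" and S: "eset_compat m \<Lambda> p S" and T: "eset_compat m \<Lambda> q T"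
  shows "lam_related m \<Lambda> (p, S) (q, T) \<longleftrightarrow>
    lam_equiv \<Lambda> p q \<or> (\<forall>i<m. side S (Suc i) = side S q \<or> side T (Suc i) = side T p)"
proof (cases "lam_equiv \<Lambda> p q \<or> S = {} \<or> T = {}")
  case True
  then show ?thesis by (auto simp: lam_related_def)
next
  case False
  then have ne: "\<not> lam_equiv \<Lambda> p q" "\<not> lam_equiv \<Lambda> q p"
    by (auto simp: lam_equiv_commute)
  have pq: "p < m" "q < m" using S T by (auto simp: eset_compat_def)
  have ST: "S \<inter> T = {}"
    using eset_equiv[OF S] eset_equiv[OF T] lam_equiv_trans[OF L] lam_equiv_sym ne(1) by blast
  have sub: "S \<subseteq> {..<m}" "T \<subseteq> {..<m}" using S T by (auto simp: eset_compat_def)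
  note s0 = eset_side[OF S] eset_side[OF T]
  note OS = Omega_eset[OF L S ne(1) pq(2)]
  note OT = Omega_eset[OF L T ne(2) pq(1)]
  have "Omega m q S \<inter> Omega m p T \<noteq> {} \<longleftrightarrow>
    (\<exists>i<m. side S (Suc i) \<noteq> side S q \<and> side T (Suc i) \<noteq> side T p)" (is "?L \<longleftrightarrow> ?R")
  proof
    assume ?R
    then obtain i where i: "i < m" "side S (Suc i) \<noteq> side S q" "side T (Suc i) \<noteq> side T p"
      by blast
    have "i \<in> Omega m q S"
      unfolding OS using i by (cases "i \<in> S") simp_all
    moreover have "i \<in> Omega m p T"
      unfolding OT using i by (cases "i \<in> T") simp_all
    ultimately show ?L by blast
  next
    assume ?L
    then obtain x where x: "x \<in> Omega m q S" "x \<in> Omega m p T" by blast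
    then have "x < m" using sub by (auto simp: OS)
    obtain j where j: "j < m" "\<And>S. side S m = 0 \<Longrightarrow> side S (Suc j) = side S x"
      using ex_gap_before[of x m] \<open>x < m\<close> by (metis gr_implies_not0 neq0_conv)
    have jS: "side S (Suc j) = side S x" and jT: "side T (Suc j) = side T x"
      using j(2) s0 by blast+
    \<comment> \<open>A cut point of one set separates its two neighbouring gaps \<open>j\<close>
      and \<open>x\<close> there but not in the other set, so one of these gaps lies in both
      \<open>Omega\<close> sets. A point outside both sets has the same sides as the gap after
      it.\<close>
    consider "x \<in> S" "x \<notin> T" | "x \<notin> S" "x \<in> T" | "x \<notin> S" "x \<notin> T" using ST by blast
    then show ?R
    proof cases
      case 1
      then have Tx: "side T x \<noteq> side T p" using x by (simp add: OT)
      show ?thesis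
      proof (cases "side S x = side S q")
        case True
        then have "side S (Suc x) \<noteq> side S q" using side_Suc_in[OF 1(1)] by simp
        with Tx 1 \<open>x < m\<close> show ?thesis by (intro exI[of _ x]) simp
      next
        case False
        with Tx jS jT j(1) show ?thesis by (intro exI[of _ j]) simp
      qed
    next
      case 2
      then have Sx: "side S x \<noteq> side S q" using x by (simp add: OS)
      show ?thesis
      proof (cases "side T x = side T p")
        case True
        then have "side T (Suc x) \<noteq> side T p" using side_Suc_in[OF 2(2)] by simp
        with Sx 2 \<open>x < m\<close> show ?thesis by (intro exI[of _ x]) simp
      next
        case False
        with Sx jS jT j(1) show ?thesis by (intro exI[of _ j]) simp
      qed
    next
      case 3
      with x \<open>x < m\<close> show ?thesis
        by (intro exI[of _ x]) (simp add: OS OT)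
    qed
  qed
  with False show ?thesis by (auto simp: lam_related_def)
qed

section \<open>Balanced vectors\<close>

text \<open>These are the linear relations of the characteristic map over the polygon that sends the
  three parts to the three nonzero vectors of \<open>Z_2^2\<close>. Each nonzero functional on
  \<open>Z_2^2\<close> kills exactly one of these vectors, so it is the indicator of the complement
  of one part.\<close>

definition balanced :: "nat \<Rightarrow> nat set set \<Rightarrow> (nat \<Rightarrow> bit) \<Rightarrow> bool" where
  "balanced m \<Lambda> x \<longleftrightarrow> (\<forall>A\<in>\<Lambda>. (\<Sum>l\<in>{..<m} - A. x l) = 0)"

definition twist :: "nat \<Rightarrow> nat set set \<Rightarrow> nat \<Rightarrow> nat set \<Rightarrow> (nat \<Rightarrow> bit) \<Rightarrow> bit" where
  "twist m \<Lambda> p S x = (\<Sum>l | l < m \<and> \<not> lam_equiv \<Lambda> p l. side S l * x l)"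

lemma twist_empty [simp]: "twist m \<Lambda> p {} x = 0"
  by (simp add: twist_def)

lemma balanced_sum:
  assumes "\<Lambda> \<in> DJ_P m" "balanced m \<Lambda> x" "p < m"
  shows "(\<Sum>l | l < m \<and> \<not> lam_equiv \<Lambda> p l. x l) = 0"
proof -
  obtain A where A: "A \<in> \<Lambda>" "p \<in> A" using DJ_P_part[OF assms(1,3)] by blast
  then have "{l. l < m \<and> \<not> lam_equiv \<Lambda> p l} = {..<m} - A"
    using lam_equiv_part[OF assms(1)] by auto
  with assms(2) A(1) show ?thesis by (auto simp: balanced_def)
qed

lemma twist_shift:
  assumes "\<Lambda> \<in> DJ_P m" "balanced m \<Lambda> x" "p < m"
  shows "twist m \<Lambda> p S x = (\<Sum>l | l < m \<and> \<not> lam_equiv \<Lambda> p l. (side S l + b) * x l)"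
  using balanced_sum[OF assms]
  by (simp add: twist_def distrib_right sum.distrib flip: sum_distrib_left)

lemma balanced_add: "balanced m \<Lambda> x \<Longrightarrow> balanced m \<Lambda> y \<Longrightarrow> balanced m \<Lambda> (\<lambda>l. x l + y l)"
  by (simp add: balanced_def sum.distrib)

lemma balanced_of_bool:
  assumes "Y \<subseteq> {..<m}" "\<And>A. A \<in> \<Lambda> \<Longrightarrow> even (card (Y - A))"
  shows "balanced m \<Lambda> (\<lambda>l. of_bool (l \<in> Y))"
  unfolding balanced_def
proof
  fix A assume "A \<in> \<Lambda>"
  have "(\<Sum>l\<in>{..<m} - A. of_bool (l \<in> Y)) = (\<Sum>l\<in>Y - A. (1::bit))"
    by (rule sum.mono_neutral_cong_right) (use assms in auto)
  also have "\<dots> = of_nat (card (Y - A))" by simp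
  also have "\<dots> = 0"
    using assms(2)[OF \<open>A \<in> \<Lambda>\<close>] by (auto elim!: evenE simp: of_nat_mult)
  finally show "(\<Sum>l\<in>{..<m} - A. of_bool (l \<in> Y)) = (0::bit)" .
qed

section \<open>The shortest relations of the polygon\<close>

lemma balanced_pair:
  assumes "\<Lambda> \<in> DJ_P m" "p < m" "q < m" "p \<noteq> q" "lam_equiv \<Lambda> p q"
  shows "balanced m \<Lambda> (\<lambda>l. of_bool (l \<in> {p, q}))"
proof (rule balanced_of_bool)
  fix A assume "A \<in> \<Lambda>"
  then have "p \<in> A \<longleftrightarrow> q \<in> A"
    using assms lam_equiv_part[OF assms(1)] lam_equiv_sym by metis
  then have "{p, q} - A = {} \<or> {p, q} - A = {p, q}" by auto
  then show "even (card ({p, q} - A))" using assms(4) by fastforce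
qed (use assms in auto)

text \<open>Three pairwise inequivalent points represent all three parts, so every part misses
  exactly two of them. In vector form: the three nonzero vectors of \<open>Z_2^2\<close> add up to
  zero.\<close>

lemma balanced_triple:
  assumes L: "\<Lambda> \<in> DJ_P m" and lt: "p < m" "q < m" "r < m"
    and ne: "\<not> lam_equiv \<Lambda> p q" "\<not> lam_equiv \<Lambda> p r" "\<not> lam_equiv \<Lambda> q r"
  shows "balanced m \<Lambda> (\<lambda>l. of_bool (l \<in> {p, q, r}))"
proof (rule balanced_of_bool)
  fix A assume A: "A \<in> \<Lambda>"
  obtain P Q R where P: "P \<in> \<Lambda>" "p \<in> P" and Q: "Q \<in> \<Lambda>" "q \<in> Q" and R: "R \<in> \<Lambda>" "r \<in> R"
    using DJ_P_part[OF L] lt by metis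
  have distinct: "p \<noteq> q" "p \<noteq> r" "q \<noteq> r" using ne lam_equiv_refl[OF L] lt by auto
  have notin: "q \<notin> P" "r \<notin> P" "r \<notin> Q" "p \<notin> Q" "p \<notin> R" "q \<notin> R"
    using ne lam_equiv_part[OF L P] lam_equiv_part[OF L Q] lam_equiv_part[OF L R] lam_equiv_commute
    by metis+
  have "P \<noteq> Q" "P \<noteq> R" "Q \<noteq> R" using P Q R notin by blast+
  then have PQR: "card {P, Q, R} = 3" by simp
  have "card \<Lambda> = 3" using L by (simp add: DJ_P_def)
  then have "{P, Q, R} = \<Lambda>"
    using P Q R PQR by (intro card_subset_eq) (auto simp: card_eq_0_iff intro: card_ge_0_finite)
  with A consider "A = P" | "A = Q" | "A = R" by blast
  then have "{p, q, r} - A = {q, r} \<or> {p, q, r} - A = {p, r} \<or> {p, q, r} - A = {p, q}"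
    by cases (use P Q R notin in blast)+
  moreover have "even (card {q, r})" "even (card {p, r})" "even (card {p, q})"
    using distinct by simp_all
  ultimately show "even (card ({p, q, r} - A))" by (elim disjE) (simp_all only:)
qed (use lt in auto)

text \<open>The vectors of an edge form a basis of \<open>Z_2^2\<close>; \<open>Y\<close> is the
  relation that expresses the vector of \<open>p\<close> in this basis.\<close>

lemma balanced_edge:
  assumes L: "\<Lambda> \<in> DJ_P m" and i: "i < m" and p: "p < m" "p \<noteq> i" "p \<noteq> Suc i mod m"
  obtains Y where "p \<in> Y" "Y \<subseteq> {p, i, Suc i mod m}" "balanced m \<Lambda> (\<lambda>l. of_bool (l \<in> Y))"
proof -
  let ?j = "Suc i mod m"
  have j: "?j < m" using i by simp
  consider "lam_equiv \<Lambda> p i" | "lam_equiv \<Lambda> p ?j" | "\<not> lam_equiv \<Lambda> p i" "\<not> lam_equiv \<Lambda> p ?j"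
    by blast
  then show ?thesis
  proof cases
    case 1 then show ?thesis using that[of "{p, i}"] balanced_pair[OF L p(1) i p(2)] by blast
  next
    case 2 then show ?thesis using that[of "{p, ?j}"] balanced_pair[OF L p(1) j p(3)] by blast
  next
    case 3 then show ?thesis
      using that[of "{p, i, ?j}"] balanced_triple[OF L p(1) i j _ _ not_lam_equiv_Suc[OF L i]] by blast
  qed
qed

text \<open>The face condition after elimination of the copies: \<open>T j\<close> is the e-set of a
  vertex over \<open>j\<close> that a face over the edge omits, and \<open>fix_x\<close> says that
  the coordinate of this vertex is zero.\<close>

lemma related_balanced_eq_0:
  assumes L: "\<Lambda> \<in> DJ_P m" and i: "i < m" and x: "balanced m \<Lambda> x"
    and T: "\<And>j. j < m \<Longrightarrow> eset_compat m \<Lambda> j (T j)"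
    and rel: "\<And>j l. j < m \<Longrightarrow> l < m \<Longrightarrow> j \<noteq> l \<Longrightarrow> lam_related m \<Lambda> (j, T j) (l, T l)"
    and fix_x: "\<And>j. j < m \<Longrightarrow> j \<noteq> i \<Longrightarrow> j \<noteq> Suc i mod m \<Longrightarrow> x j = twist m \<Lambda> j (T j) x"
    and l: "l < m"
  shows "x l = 0"
proof -
  define far where "far j = {g. g < m \<and> side (T j) (Suc g) \<noteq> side (T j) (Suc i)}" for j
  define N where "N = {j. j < m \<and> j \<noteq> i \<and> j \<noteq> Suc i mod m \<and> x j = 1}"
  have fin: "finite (far j)" for j by (simp add: far_def)
  text \<open>The off-diagonal matrix of the twists, written in the basis that omits \<open>i\<close> and \<open>i + 1\<close>,
    is nilpotent: along every nonzero entry the set of gaps cut off from the edge shrinks.\<close>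
  have succ: "\<exists>l\<in>N. \<not> lam_equiv \<Lambda> j l \<and> side (T j) l \<noteq> side (T j) (Suc i)" if "j \<in> N" for j
  proof -
    have j: "j < m" "j \<noteq> i" "j \<noteq> Suc i mod m" "x j = 1" using that by (auto simp: N_def)
    let ?s = "side (T j) (Suc i)"
    \<comment> \<open>Normalising by the side of the gap \<open>i\<close> kills the coefficients at
      both ends of the edge, so a nonzero term must come from a point of \<open>N\<close>.\<close>
    have "(\<Sum>l | l < m \<and> \<not> lam_equiv \<Lambda> j l. (side (T j) l + ?s) * x l) \<noteq> 0"
      using fix_x[OF j(1-3)] twist_shift[OF L x j(1)] j(4) by simp
    then obtain l where l: "l < m" "\<not> lam_equiv \<Lambda> j l" "(side (T j) l + ?s) * x l \<noteq> 0"
      using sum.neutral[of "{l. l < m \<and> \<not> lam_equiv \<Lambda> j l}" "\<lambda>l. (side (T j) l + ?s) * x l"]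
      by blast
    then have xl: "x l = 1" and sl: "side (T j) l \<noteq> ?s" by auto
    have "l \<notin> T j" using eset_notin[OF T[OF j(1)] l(2)] .
    then have "l \<noteq> i" using sl side_Suc_notin by metis
    moreover have "l \<noteq> Suc i mod m"
      using sl side_Suc_mod[OF eset_side[OF T[OF j(1)]] i] by metis
    ultimately show ?thesis using l xl sl by (auto simp: N_def)
  qed
  have shrink: "far l \<subset> far j"
    if "j \<in> N" "l \<in> N" and jl: "\<not> lam_equiv \<Lambda> j l" "side (T j) l \<noteq> side (T j) (Suc i)" for j l
  proof -
    have lt: "j < m" "l < m" using that by (auto simp: N_def)
    have ne: "j \<noteq> l" using jl lam_equiv_refl[OF L] lt by auto
    have gaps: "side (T j) (Suc g) = side (T j) l \<or> side (T l) (Suc g) = side (T l) j" if "g < m" for g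
      using rel[OF lt ne] jl(1) that
      unfolding lam_related_iff[OF L T[OF lt(1)] T[OF lt(2)]] by blast
    \<comment> \<open>\<open>T j\<close> separates \<open>l\<close> from the gap \<open>i\<close>,
      so relatedness keeps the gap \<open>i\<close> on the side of \<open>j\<close> with respect to
      \<open>T l\<close>. A gap that \<open>T l\<close> cuts off from \<open>j\<close> must then lie
      on the side of \<open>l\<close> in \<open>T j\<close>, hence away from the edge.\<close>
    have lj: "side (T l) (Suc i) = side (T l) j"
      using gaps[OF i] jl(2) by metis
    have sub: "far l \<subseteq> far j"
    proof
      fix g assume "g \<in> far l"
      then have g: "g < m" "side (T l) (Suc g) \<noteq> side (T l) j" by (auto simp: far_def lj)
      with gaps[OF g(1)] jl(2) show "g \<in> far j" by (auto simp: far_def)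
    qed
    \<comment> \<open>Strictness comes from a point \<open>s\<close> of \<open>T l\<close>: the gaps
      on its two sides are separated by \<open>T l\<close> but not by \<open>T j\<close>. One of
      them is in \<open>far l\<close>, hence both are in \<open>far j\<close>, and the other
      witnesses the difference.\<close>
    have "T l \<noteq> {}"
    proof
      assume "T l = {}"
      moreover obtain h where "side (T l) h \<noteq> side (T l) (Suc i)"
        using succ[OF \<open>l \<in> N\<close>] by blast
      ultimately show False by simp
    qed
    then obtain s where s: "s \<in> T l" by blast
    then have "s < m" using T[OF lt(2)] by (auto simp: eset_compat_def)
    have "s \<notin> T j"
      using eset_equiv[OF T[OF lt(1)]] eset_equiv[OF T[OF lt(2)] s] jl(1)
        lam_equiv_trans[OF L] lam_equiv_sym by blast
    obtain h where h: "h < m" "\<And>S. side S m = 0 \<Longrightarrow> side S (Suc h) = side S s"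
      using ex_gap_before[of s m] \<open>s < m\<close> by (metis gr_implies_not0 neq0_conv)
    have hl: "side (T l) (Suc h) = side (T l) s" and hj: "side (T j) (Suc h) = side (T j) s"
      using h(2) eset_side[OF T] lt by blast+
    have same: "s \<in> far j \<longleftrightarrow> h \<in> far j"
      using \<open>s < m\<close> \<open>h < m\<close> hj \<open>s \<notin> T j\<close> by (simp add: far_def)
    have "s \<in> far l \<longleftrightarrow> h \<notin> far l"
      using side_Suc_in[OF s] \<open>s < m\<close> \<open>h < m\<close> hl bit_neq_trans[of "side (T l) (Suc s)" "side (T l) s" "side (T l) (Suc i)"]
      by (auto simp: far_def)
    then have "\<exists>g. g \<in> far j \<and> g \<notin> far l"
      using same sub by blast
    with sub show ?thesis by blast
  qed
  have "N = {}"
  proof (rule ccontr)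
    assume "N \<noteq> {}"
    then obtain j0 where "j0 \<in> N" by blast
    then obtain j where j: "j \<in> N" "\<And>l. l \<in> N \<Longrightarrow> card (far j) \<le> card (far l)"
      using ex_has_least_nat[of "\<lambda>j. j \<in> N" j0 "\<lambda>j. card (far j)"] by blast
    from succ[OF j(1)] obtain l where l: "l \<in> N" "\<not> lam_equiv \<Lambda> j l"
        "side (T j) l \<noteq> side (T j) (Suc i)" by blast
    from psubset_card_mono[OF fin shrink[OF j(1) l]] j(2)[OF l(1)] show False by simp
  qed
  then have zero: "x l = 0" if "l < m" "l \<noteq> i" "l \<noteq> Suc i mod m" for l
    using that by (auto simp: N_def)
  \<comment> \<open>Once \<open>x\<close> is supported on the edge, the balance condition for the
    part of one end sees only the coefficient at the other end.\<close>
  have edge: "x b = 0" if "a < m" "b < m" "\<not> lam_equiv \<Lambda> a b"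
    "\<And>l. l < m \<Longrightarrow> l \<noteq> a \<Longrightarrow> l \<noteq> b \<Longrightarrow> x l = 0" for a b
  proof -
    have "(\<Sum>l | l < m \<and> \<not> lam_equiv \<Lambda> a l. x l) = (\<Sum>l\<in>{b}. x l)"
    proof (rule sum.mono_neutral_right)
      show "\<forall>l\<in>{l. l < m \<and> \<not> lam_equiv \<Lambda> a l} - {b}. x l = 0"
        using that(4) lam_equiv_refl[OF L that(1)] by blast
    qed (use that in auto)
    with balanced_sum[OF L x that(1)] show ?thesis by simp
  qed
  have j: "Suc i mod m < m" using i by simp
  have "\<not> lam_equiv \<Lambda> i (Suc i mod m)" by (rule not_lam_equiv_Suc[OF L i])
  with edge[OF i j] edge[OF j i] zero lam_equiv_commute have "x (Suc i mod m) = 0" "x i = 0"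
    by metis+
  with zero[OF l] show ?thesis by metis
qed

section \<open>Faces of the polygon and of its blow-ups\<close>

lemma faces_P_iff:
  assumes "m \<ge> 3"
  shows "\<sigma> \<in> faces_P m \<longleftrightarrow> (\<exists>i<m. \<sigma> \<subseteq> {i, Suc i mod m})"
proof
  assume "\<sigma> \<in> faces_P m"
  then have s: "\<sigma> \<subseteq> {0..<m}" "card \<sigma> \<le> 1 \<or> (\<exists>i<m. \<sigma> = {i, Suc i mod m})"
    by (auto simp: faces_P_def)
  show "\<exists>i<m. \<sigma> \<subseteq> {i, Suc i mod m}"
  proof (cases "\<exists>i<m. \<sigma> = {i, Suc i mod m}")
    case False
    with s have "card \<sigma> \<le> Suc 0" "finite \<sigma>" by (auto intro: finite_subset)
    then have eq: "\<forall>x\<in>\<sigma>. \<forall>y\<in>\<sigma>. x = y"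
      by (simp add: card_le_Suc0_iff_eq)
    show ?thesis
    proof (cases "\<sigma> = {}")
      case True
      with assms show ?thesis by (intro exI[of _ 0]) simp
    next
      case False
      then obtain i where "i \<in> \<sigma>" by blast
      with eq have "\<sigma> = {i}" by blast
      with s(1) show ?thesis by (intro exI[of _ i]) simp
    qed
  qed auto
next
  assume "\<exists>i<m. \<sigma> \<subseteq> {i, Suc i mod m}"
  then obtain i where i: "i < m" "\<sigma> \<subseteq> {i, Suc i mod m}" by blast
  then have "\<sigma> \<in> {{}, {i}, {Suc i mod m}, {i, Suc i mod m}}" by blast
  moreover have "\<sigma> \<subseteq> {0..<m}" using i by auto
  ultimately show "\<sigma> \<in> faces_P m" using i(1) by (auto simp: faces_P_def)
qed

lemma min_nonface_exists:
  assumes "finite F" "F \<subseteq> V" "F \<notin> K"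
  shows "\<exists>\<tau>\<in>min_nonfaces V K. \<tau> \<subseteq> F"
proof -
  have "finite {\<tau>. \<tau> \<subseteq> F \<and> \<tau> \<notin> K}" using assms(1) by simp
  moreover have "F \<in> {\<tau>. \<tau> \<subseteq> F \<and> \<tau> \<notin> K}" using assms(3) by simp
  ultimately have "\<exists>\<tau>\<in>{\<tau>. \<tau> \<subseteq> F \<and> \<tau> \<notin> K}. \<tau> \<subseteq> F \<and>
      (\<forall>\<rho>\<in>{\<tau>. \<tau> \<subseteq> F \<and> \<tau> \<notin> K}. \<rho> \<subseteq> \<tau> \<longrightarrow> \<tau> = \<rho>)"
    by (rule finite_has_minimal2)
  then obtain \<tau> where \<tau>: "\<tau> \<subseteq> F" "\<tau> \<notin> K"
      "\<forall>\<rho>\<in>{\<tau>. \<tau> \<subseteq> F \<and> \<tau> \<notin> K}. \<rho> \<subseteq> \<tau> \<longrightarrow> \<tau> = \<rho>" by blast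
  have "\<tau> - {x} \<in> K" if "x \<in> \<tau>" for x
  proof (rule ccontr)
    assume "\<tau> - {x} \<notin> K"
    then have "\<tau> = \<tau> - {x}" using \<tau>(1) by (intro \<tau>(3)[rule_format]) auto
    with that show False by blast
  qed
  then have "\<tau> \<in> min_nonfaces V K"
    using \<tau>(1,2) assms(2) by (auto simp: min_nonfaces_def)
  with \<tau>(1) show ?thesis by blast
qed

text \<open>A blow-up lies in \<open>\<sigma>\<close> exactly if the blown-up set lies in the set
  \<open>F\<close> of vertices whose whole fibre is in \<open>\<sigma>\<close>. So
  \<open>\<sigma>\<close> is a face if and only if \<open>F\<close> is a face of the polygon, that
  is, lies in an edge.\<close>

lemma faces_PJ_iff:
  assumes "m \<ge> 3"
  shows "\<sigma> \<in> faces_PJ m J \<longleftrightarrow> \<sigma> \<subseteq> verts_J m J \<and>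
    (\<exists>i<m. \<forall>j<m. j \<noteq> i \<longrightarrow> j \<noteq> Suc i mod m \<longrightarrow> (\<exists>k<J j. (j, k) \<notin> \<sigma>))"
proof -
  define F where "F = {j. j < m \<and> (\<forall>k<J j. (j, k) \<in> \<sigma>)}"
  have F: "finite F" "F \<subseteq> {0..<m}" by (auto simp: F_def)
  have "blowup J \<tau> \<subseteq> \<sigma> \<longleftrightarrow> \<tau> \<subseteq> F" if "\<tau> \<subseteq> {0..<m}" for \<tau>
    using that by (auto simp: F_def blowup_def)
  then have "(\<forall>\<tau>\<in>min_nonfaces {0..<m} (faces_P m). \<not> blowup J \<tau> \<subseteq> \<sigma>) \<longleftrightarrow>
      (\<forall>\<tau>\<in>min_nonfaces {0..<m} (faces_P m). \<not> \<tau> \<subseteq> F)"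
    by (intro ball_cong refl) (simp add: min_nonfaces_def)
  also have "\<dots> \<longleftrightarrow> F \<in> faces_P m"
  proof
    assume "\<forall>\<tau>\<in>min_nonfaces {0..<m} (faces_P m). \<not> \<tau> \<subseteq> F"
    then show "F \<in> faces_P m" using min_nonface_exists[OF F] by blast
  next
    assume *: "F \<in> faces_P m"
    have "\<tau> \<in> faces_P m" if "\<tau> \<subseteq> F" for \<tau>
      using * that unfolding faces_P_iff[OF assms] by blast
    then show "\<forall>\<tau>\<in>min_nonfaces {0..<m} (faces_P m). \<not> \<tau> \<subseteq> F"
      by (auto simp: min_nonfaces_def)
  qed
  also have "\<dots> \<longleftrightarrow> (\<exists>i<m. \<forall>j<m. j \<noteq> i \<longrightarrow> j \<noteq> Suc i mod m \<longrightarrow> (\<exists>k<J j. (j, k) \<notin> \<sigma>))"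
    unfolding faces_P_iff[OF assms] F_def by blast
  finally show ?thesis
    by (simp add: faces_PJ_def)
qed

lemma finite_verts_J: "finite (verts_J m J)"
proof (rule finite_subset)
  show "verts_J m J \<subseteq> (SIGMA i:{..<m}. {..<J i})" by (auto simp: verts_J_def)
qed auto

lemma finite_E_index: "finite (E_index m J)"
proof (rule finite_subset)
  show "E_index m J \<subseteq> verts_J m J" by (auto simp: E_index_def verts_J_def)
qed (rule finite_verts_J)

lemma verts_J_eq:
  assumes "\<forall>i<m. J i > 0"
  shows "verts_J m J = (\<lambda>(i, k). (i, Suc k)) ` E_index m J \<union> (\<lambda>i. (i, 0)) ` {..<m}"
    (is "_ = ?R")
proof (intro equalityI subrelI)
  fix i k assume "(i, k) \<in> verts_J m J"
  then show "(i, k) \<in> ?R"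
    by (cases k) (auto simp: verts_J_def E_index_def intro!: rev_image_eqI)
next
  fix i k assume "(i, k) \<in> ?R"
  then show "(i, k) \<in> verts_J m J"
    using assms by (auto simp: verts_J_def E_index_def)
qed

lemma card_verts_J:
  assumes "\<forall>i<m. J i > 0"
  shows "card (verts_J m J) = card (E_index m J) + m"
proof -
  have "card ((\<lambda>(i, k). (i, Suc k)) ` E_index m J) = card (E_index m J)"
    by (rule card_image) (auto simp: inj_on_def)
  moreover have "card ((\<lambda>i. (i, 0::nat)) ` {..<m}) = m"
    by (subst card_image) (auto simp: inj_on_def)
  ultimately show ?thesis
    unfolding verts_J_eq[OF assms]
    by (subst card_Un_disjoint) (auto simp: finite_E_index)
qed

text \<open>A facet over the edge \<open>{0, 1}\<close>. The removed vertices \<open>(j, 0)\<close>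
  with \<open>2 \<le> j\<close> later serve as the free coordinates of the kernel.\<close>

definition std_facet :: "nat \<Rightarrow> (nat \<Rightarrow> nat) \<Rightarrow> (nat \<times> nat) set" where
  "std_facet m J = verts_J m J - (\<lambda>j. (j, 0)) ` {2..<m}"

lemma std_facet_face:
  assumes "m \<ge> 3" "\<forall>i<m. J i > 0"
  shows "std_facet m J \<in> faces_PJ m J"
  unfolding faces_PJ_iff[OF assms(1)]
proof
  show "\<exists>i<m. \<forall>j<m. j \<noteq> i \<longrightarrow> j \<noteq> Suc i mod m \<longrightarrow> (\<exists>k<J j. (j, k) \<notin> std_facet m J)"
  proof (rule exI[of _ 0], intro conjI allI impI)
    fix j assume "j < m" "j \<noteq> 0" "j \<noteq> Suc 0 mod m"
    then show "\<exists>k<J j. (j, k) \<notin> std_facet m J"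
      using assms by (intro exI[of _ 0]) (auto simp: std_facet_def)
  qed (use assms in auto)
qed (auto simp: std_facet_def)

lemma card_std_facet:
  assumes "m \<ge> 3" "\<forall>i<m. J i > 0"
  shows "card (std_facet m J) = card (E_index m J) + 2"
proof -
  have "(\<lambda>j. (j, 0)) ` {2..<m} \<subseteq> verts_J m J"
    using assms(2) by (auto simp: verts_J_def)
  moreover have "card ((\<lambda>j. (j, 0::nat)) ` {2..<m}) = m - 2"
    by (subst card_image) (auto simp: inj_on_def)
  ultimately show ?thesis
    unfolding std_facet_def using assms(1) card_verts_J[OF assms(2)]
    by (subst card_Diff_subset) auto
qed

text \<open>Each of the at least \<open>m - 2\<close> fibres off the edge loses a vertex, and
  \<open>E_index m J\<close> has \<open>m\<close> elements fewer than the vertex set.\<close>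

lemma card_face_le:
  assumes "m \<ge> 3" "\<forall>i<m. J i > 0" "\<sigma> \<in> faces_PJ m J"
  shows "card \<sigma> \<le> card (E_index m J) + 2"
proof -
  obtain i where i: "i < m" "\<And>j. j < m \<Longrightarrow> j \<noteq> i \<Longrightarrow> j \<noteq> Suc i mod m \<Longrightarrow> \<exists>k<J j. (j, k) \<notin> \<sigma>"
    using assms(3) unfolding faces_PJ_iff[OF assms(1)] by blast
  have sub: "\<sigma> \<subseteq> verts_J m J" using assms(3) by (simp add: faces_PJ_def)
  have fin: "finite (verts_J m J - \<sigma>)" using finite_verts_J by blast
  have "{..<m} - {i, Suc i mod m} \<subseteq> fst ` (verts_J m J - \<sigma>)"
    using i(2) by (force simp: verts_J_def)
  then have "card ({..<m} - {i, Suc i mod m}) \<le> card (verts_J m J - \<sigma>)"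
    using card_mono[OF finite_imageI[OF fin]] card_image_le[OF fin] le_trans by blast
  moreover have "m - card {i, Suc i mod m} \<le> card ({..<m} - {i, Suc i mod m})"
    using diff_card_le_card_Diff[of "{i, Suc i mod m}" "{..<m}"] by simp
  moreover have "card {i, Suc i mod m} \<le> 2"
    by (simp add: card_insert_if)
  moreover have "card (verts_J m J - \<sigma>) = card (verts_J m J) - card \<sigma>" "card \<sigma> \<le> card (verts_J m J)"
    using card_Diff_subset[OF finite_subset[OF sub finite_verts_J] sub]
      card_mono[OF finite_verts_J sub] by simp_all
  ultimately show ?thesis
    using card_verts_J[OF assms(2)] assms(1) by linarith
qed

lemma dimp1_faces_PJ:
  assumes "m \<ge> 3" "\<forall>i<m. J i > 0"
  shows "dimp1 (faces_PJ m J) = card (E_index m J) + 2"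
  unfolding dimp1_def
proof (rule Max_eqI)
  have "faces_PJ m J \<subseteq> Pow (verts_J m J)" by (auto simp: faces_PJ_def)
  then show "finite (card ` faces_PJ m J)"
    using finite_verts_J finite_subset by blast
  show "card (E_index m J) + 2 \<in> card ` faces_PJ m J"
    using std_facet_face[OF assms] card_std_facet[OF assms] by (metis imageI)
qed (use card_face_le[OF assms] in auto)

section \<open>Characteristic maps and their kernels\<close>

definition Ker :: "'v set \<Rightarrow> ('v \<Rightarrow> nat \<Rightarrow> bit) \<Rightarrow> ('v \<Rightarrow> bit) set" where
  "Ker V chi = {c. (\<forall>v. v \<notin> V \<longrightarrow> c v = 0) \<and> (\<forall>i. (\<Sum>v\<in>V. c v * chi v i) = 0)}"

lemma char_maps_iff_Ker:
  assumes "finite V" "\<And>\<sigma>. \<sigma> \<in> K \<Longrightarrow> \<sigma> \<subseteq> V"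
  shows "chi \<in> char_maps V K n \<longleftrightarrow> (\<forall>v i. v \<notin> V \<or> n \<le> i \<longrightarrow> chi v i = 0) \<and>
    (\<forall>\<sigma>\<in>K. \<forall>c\<in>Ker V chi. (\<forall>v. v \<notin> \<sigma> \<longrightarrow> c v = 0) \<longrightarrow> c = (\<lambda>v. 0))" (is "_ \<longleftrightarrow> _ \<and> ?R")
proof -
  have sum_eq: "(\<Sum>v\<in>V. c v * chi v i) = (\<Sum>v\<in>\<sigma>. c v * chi v i)"
    if "\<sigma> \<in> K" "\<And>v. v \<notin> \<sigma> \<Longrightarrow> c v = 0" for \<sigma> c i
    by (rule sum.mono_neutral_right) (use assms that in auto)
  have "(\<forall>\<sigma>\<in>K. \<forall>c :: 'a \<Rightarrow> bit. (\<forall>i. (\<Sum>v\<in>\<sigma>. c v * chi v i) = 0) \<longrightarrow> (\<forall>v\<in>\<sigma>. c v = 0)) \<longleftrightarrow> ?R"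
    (is "?L \<longleftrightarrow> _")
  proof
    assume L: ?L
    show ?R
    proof (intro ballI impI)
      fix \<sigma> c assume s: "\<sigma> \<in> K" "c \<in> Ker V chi" "\<forall>v. v \<notin> \<sigma> \<longrightarrow> c v = 0"
      then have "\<forall>i. (\<Sum>v\<in>\<sigma>. c v * chi v i) = 0"
        using sum_eq[of \<sigma> c] by (simp add: Ker_def)
      with L s(1) have "\<forall>v\<in>\<sigma>. c v = 0" by blast
      with s(3) show "c = (\<lambda>v. 0)" by blast
    qed
  next
    assume R: ?R
    show ?L
    proof (intro ballI allI impI)
      fix \<sigma> c v assume s: "\<sigma> \<in> K" "\<forall>i. (\<Sum>v\<in>\<sigma>. c v * chi v i) = 0" "v \<in> \<sigma>"
      define d where "d = (\<lambda>v. if v \<in> \<sigma> then c v else 0)"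
      have "(\<Sum>v\<in>V. d v * chi v i) = (\<Sum>v\<in>\<sigma>. c v * chi v i)" for i
        using sum_eq[OF s(1), of d] by (simp add: d_def)
      then have "d \<in> Ker V chi"
        using s(2) assms(2)[OF s(1)] by (auto simp: Ker_def d_def)
      with R s(1) have "d = (\<lambda>v. 0)" by (simp add: d_def)
      then show "c v = 0" using s(3) by (metis d_def)
    qed
  qed
  then show ?thesis by (auto simp: char_maps_def)
qed

section \<open>Equality of kernels and the action of \<open>GL\<close>\<close>

lemma card_bit_functions:
  assumes "finite A"
  shows "finite {c :: 'a \<Rightarrow> bit. \<forall>v. v \<notin> A \<longrightarrow> c v = 0}"
    and "card {c :: 'a \<Rightarrow> bit. \<forall>v. v \<notin> A \<longrightarrow> c v = 0} = 2 ^ card A"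
proof -
  let ?C = "{c :: 'a \<Rightarrow> bit. \<forall>v. v \<notin> A \<longrightarrow> c v = 0}"
  have "bij_betw (\<lambda>X v. of_bool (v \<in> X) :: bit) (Pow A) ?C"
  proof (rule bij_betw_byWitness[of _ "\<lambda>c. {v. c v = 1}"])
    show "\<forall>c\<in>?C. (\<lambda>v. of_bool (v \<in> {v. c v = 1})) = c"
    proof
      fix c :: "'a \<Rightarrow> bit"
      show "(\<lambda>v. of_bool (v \<in> {v. c v = 1})) = c"
      proof
        fix v show "of_bool (v \<in> {v. c v = 1}) = c v" by (cases "c v") simp_all
      qed
    qed
  qed auto
  from bij_betw_finite[OF this] bij_betw_same_card[OF this]
  show "finite ?C" "card ?C = 2 ^ card A"
    using card_Pow[OF assms] finite_Pow_iff[of A] assms by simp_all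
qed

text \<open>By counting: independence makes the map from coefficients to combinations injective, and
  source and target both have \<open>2 ^ n\<close> elements.\<close>

lemma independent_spans:
  fixes chi :: "'v \<Rightarrow> nat \<Rightarrow> bit"
  assumes "finite \<sigma>" "card \<sigma> = n" "\<And>v i. n \<le> i \<Longrightarrow> chi v i = 0"
    and ind: "\<And>c. \<forall>i. (\<Sum>v\<in>\<sigma>. c v * chi v i) = 0 \<Longrightarrow> \<forall>v\<in>\<sigma>. c v = 0"
    and y: "\<And>i. n \<le> i \<Longrightarrow> y i = 0"
  obtains c where "\<And>v. v \<notin> \<sigma> \<Longrightarrow> c v = 0" "\<And>i. (\<Sum>v\<in>\<sigma>. c v * chi v i) = y i"
proof -
  let ?C = "{c :: 'v \<Rightarrow> bit. \<forall>v. v \<notin> \<sigma> \<longrightarrow> c v = 0}"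
  let ?Y = "{y :: nat \<Rightarrow> bit. \<forall>i. i \<notin> {..<n} \<longrightarrow> y i = 0}"
  let ?f = "\<lambda>c i. \<Sum>v\<in>\<sigma>. c v * chi v i"
  have "inj_on ?f ?C"
  proof (rule inj_onI)
    fix c d assume cd: "c \<in> ?C" "d \<in> ?C" "?f c = ?f d"
    have "(\<Sum>v\<in>\<sigma>. (c v + d v) * chi v i) = 0" for i
      using fun_cong[OF cd(3), of i] by (simp add: distrib_right sum.distrib)
    then have "\<forall>v\<in>\<sigma>. c v + d v = 0" using ind[of "\<lambda>v. c v + d v"] by blast
    then have "\<forall>v\<in>\<sigma>. c v = d v" by simp
    moreover have "c v = d v" if "v \<notin> \<sigma>" for v using cd(1,2) that by simp
    ultimately show "c = d" by blast
  qed
  then have "card (?f ` ?C) = 2 ^ n"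
    using card_bit_functions(2)[OF assms(1)] assms(2) by (simp add: card_image)
  moreover have "?f ` ?C \<subseteq> ?Y" using assms(3) by auto
  moreover have "finite ?Y" "card ?Y = 2 ^ n"
    using card_bit_functions[of "{..<n}"] by auto
  ultimately have "?f ` ?C = ?Y" by (intro card_subset_eq) auto
  moreover have "y \<in> ?Y" using y by auto
  ultimately obtain c where c: "c \<in> ?C" "y = ?f c" by blast
  show ?thesis
    by (rule that[of c]) (use c in auto)
qed

text \<open>The family \<open>q\<close> writes the unit vectors as combinations of
  \<open>chi\<close> over the facet, and column \<open>j\<close> of \<open>A\<close> is the same
  combination of \<open>chi'\<close>. Adding to any vertex \<open>v\<close> the facet combination
  that represents \<open>chi v\<close> gives a relation of \<open>chi\<close>; as it also holds for
  \<open>chi'\<close>, it determines \<open>chi' v\<close>.\<close>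

lemma Ker_subset_transform:
  assumes "finite V" "\<sigma> \<subseteq> V"
    and zero: "\<And>v i. n \<le> i \<Longrightarrow> chi v i = 0"
    and q: "\<And>j v. v \<notin> \<sigma> \<Longrightarrow> q j v = 0" "\<And>j i. j < n \<Longrightarrow> (\<Sum>u\<in>\<sigma>. q j u * chi u i) = of_bool (i = j)"
    and sub: "Ker V chi \<subseteq> Ker V chi'"
  obtains A where "\<And>v i. v \<in> V \<Longrightarrow> chi' v i = (\<Sum>k<n. A i k * chi v k)"
proof -
  define A where "A i k = (\<Sum>u\<in>\<sigma>. q k u * chi' u i)" for i k
  have "chi' v i = (\<Sum>k<n. A i k * chi v k)" if "v \<in> V" for v i
  proof -
    define c where "c u = (\<Sum>k<n. chi v k * q k u)" for u
    have c: "(\<Sum>u\<in>V. c u * f u) = (\<Sum>k<n. chi v k * (\<Sum>u\<in>\<sigma>. q k u * f u))" for f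
    proof -
      have "(\<Sum>u\<in>V. c u * f u) = (\<Sum>u\<in>\<sigma>. c u * f u)"
        by (rule sum.mono_neutral_right) (use assms(1,2) q(1) in \<open>auto simp: c_def\<close>)
      also have "\<dots> = (\<Sum>u\<in>\<sigma>. \<Sum>k<n. chi v k * (q k u * f u))"
        by (simp add: c_def sum_distrib_right mult.assoc)
      also have "\<dots> = (\<Sum>k<n. \<Sum>u\<in>\<sigma>. chi v k * (q k u * f u))"
        by (rule sum.swap)
      finally show ?thesis by (simp add: sum_distrib_left)
    qed
    have delta: "(\<Sum>u\<in>V. of_bool (u = v) * f u) = f v" for f :: "'a \<Rightarrow> bit"
      using that assms(1) by (simp add: of_bool_def if_distrib[of "\<lambda>x. x * _"] cong: if_cong)
    have "(\<Sum>u\<in>V. c u * chi u i) = chi v i" for i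
    proof -
      have "(\<Sum>u\<in>V. c u * chi u i) = (\<Sum>k<n. chi v k * of_bool (i = k))"
        unfolding c using q(2) by (intro sum.cong) auto
      also have "\<dots> = chi v i"
        using zero[of i v] by (cases "i < n") (auto simp: of_bool_def if_distrib[of "\<lambda>x. _ * x"] cong: if_cong)
      finally show ?thesis .
    qed
    moreover have "c u = 0" if "u \<notin> V" for u
      unfolding c_def using q(1) assms(2) that by (intro sum.neutral) auto
    ultimately have "(\<lambda>u. of_bool (u = v) + c u) \<in> Ker V chi"
      using that by (auto simp: Ker_def distrib_right sum.distrib delta)
    with sub have "(\<lambda>u. of_bool (u = v) + c u) \<in> Ker V chi'" by blast
    then have "chi' v i = (\<Sum>u\<in>V. c u * chi' u i)"
      by (simp add: Ker_def distrib_right sum.distrib delta)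
    also have "\<dots> = (\<Sum>k<n. A i k * chi v k)"
      unfolding c A_def by (simp add: mult.commute)
    finally show ?thesis .
  qed
  then show ?thesis by (rule that)
qed

text \<open>On the values of \<open>chi\<close> over the facet, \<open>B\<close> after
  \<open>A\<close> is the identity, and by \<open>q\<close> these values generate the unit
  vectors.\<close>

lemma transform_compose:
  fixes chi chi' :: "'v \<Rightarrow> nat \<Rightarrow> bit"
  assumes q: "\<And>j i. j < n \<Longrightarrow> (\<Sum>u\<in>\<sigma>. q j u * chi u i) = of_bool (i = j)"
    and A: "\<And>v i. v \<in> \<sigma> \<Longrightarrow> chi' v i = (\<Sum>k<n. A i k * chi v k)"
    and B: "\<And>v i. v \<in> \<sigma> \<Longrightarrow> chi v i = (\<Sum>k<n. B i k * chi' v k)"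
    and j: "j < n"
  shows "(\<Sum>k<n. B i k * A k j) = of_bool (i = j)"
proof -
  have swap: "(\<Sum>k<n. M i k * (\<Sum>u\<in>\<sigma>. q j u * h u k)) = (\<Sum>u\<in>\<sigma>. q j u * (\<Sum>k<n. M i k * h u k))"
    for M :: "nat \<Rightarrow> nat \<Rightarrow> bit" and h i
    by (subst (1 2) sum_distrib_left, subst sum.swap) (simp add: mult.left_commute)
  have "A k j = (\<Sum>l<n. A k l * of_bool (l = j))" for k
    using j by (simp add: of_bool_def if_distrib[of "\<lambda>x. _ * x"] cong: if_cong)
  also have "\<dots> k = (\<Sum>u\<in>\<sigma>. q j u * chi' u k)" for k
    using swap[of A k chi] by (simp add: q[OF j] A)
  finally have "(\<Sum>k<n. B i k * A k j) = (\<Sum>u\<in>\<sigma>. q j u * chi u i)"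
    using swap[of B i chi'] by (simp add: B)
  with q[OF j] show ?thesis by simp
qed

lemma transform_Ker_subset:
  assumes "\<And>v i. v \<in> V \<Longrightarrow> i < n \<Longrightarrow> chi' v i = (\<Sum>k<n. A i k * chi v k)"
    and "\<And>v i. n \<le> i \<Longrightarrow> chi' v i = 0"
  shows "Ker V chi \<subseteq> Ker V chi'"
proof
  fix c assume c: "c \<in> Ker V chi"
  have "(\<Sum>v\<in>V. c v * chi' v i) = 0" for i
  proof (cases "i < n")
    case True
    then have "(\<Sum>v\<in>V. c v * chi' v i) = (\<Sum>v\<in>V. \<Sum>k<n. A i k * (c v * chi v k))"
      using assms(1) by (intro sum.cong) (simp_all add: sum_distrib_left mult.left_commute)
    also have "\<dots> = (\<Sum>k<n. A i k * (\<Sum>v\<in>V. c v * chi v k))"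
      by (subst sum.swap) (simp add: sum_distrib_left)
    also have "\<dots> = 0" using c by (simp add: Ker_def)
    finally show ?thesis .
  qed (simp add: assms(2))
  with c show "c \<in> Ker V chi'" by (simp add: Ker_def)
qed

lemma char_maps_spans:
  assumes "finite V" "\<sigma> \<in> K" "\<sigma> \<subseteq> V" "card \<sigma> = n" "chi \<in> char_maps V K n"
    and "\<And>i. n \<le> i \<Longrightarrow> y i = 0"
  obtains c where "\<And>v. v \<notin> \<sigma> \<Longrightarrow> c v = 0" "\<And>i. (\<Sum>v\<in>\<sigma>. c v * chi v i) = y i"
proof (rule independent_spans[of \<sigma> n chi y])
  show "finite \<sigma>" using assms(1,3) finite_subset by blast
  show "chi v i = 0" if "n \<le> i" for v i using assms(5) that by (simp add: char_maps_def)
  show "\<forall>v\<in>\<sigma>. c v = 0" if "\<forall>i. (\<Sum>v\<in>\<sigma>. c v * chi v i) = 0" for c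
    using assms(2,5) that by (simp add: char_maps_def)
qed (use assms that in auto)

lemma DJ_rel_iff:
  assumes "finite V" "\<sigma> \<in> K" "\<sigma> \<subseteq> V" "card \<sigma> = n"
  shows "(chi, chi') \<in> DJ_rel V K n \<longleftrightarrow>
    chi \<in> char_maps V K n \<and> chi' \<in> char_maps V K n \<and> Ker V chi = Ker V chi'"
proof
  assume "(chi, chi') \<in> DJ_rel V K n"
  then obtain A where A: "chi \<in> char_maps V K n" "chi' \<in> char_maps V K n" "invertible_Z2 n A"
      "\<And>v i. v \<in> V \<Longrightarrow> i < n \<Longrightarrow> chi' v i = (\<Sum>k<n. A i k * chi v k)"
    by (auto simp: DJ_rel_def)
  from A(3) obtain B where "\<forall>i<n. \<forall>j<n. (\<Sum>k<n. A i k * B k j) = (if i = j then 1 else 0) \<and>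
      (\<Sum>k<n. B i k * A k j) = (if i = j then 1 else 0)"
    unfolding invertible_Z2_def by (rule exE)
  then have B: "(\<Sum>k<n. B i k * A k j) = of_bool (i = j)" if "i < n" "j < n" for i j
    using that by (simp add: of_bool_def)
  have zero: "chi v i = 0" "chi' v i = 0" if "n \<le> i" for v i
    using A(1,2) that by (auto simp: char_maps_def)
  have "chi v i = (\<Sum>k<n. B i k * chi' v k)" if "v \<in> V" "i < n" for v i
  proof -
    have "(\<Sum>k<n. B i k * chi' v k) = (\<Sum>k<n. \<Sum>j<n. (B i k * A k j) * chi v j)"
      using A(4) that by (simp add: sum_distrib_left mult.assoc)
    also have "\<dots> = (\<Sum>j<n. (\<Sum>k<n. B i k * A k j) * chi v j)"
      by (subst sum.swap) (simp add: sum_distrib_right)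
    also have "\<dots> = (\<Sum>j<n. of_bool (i = j) * chi v j)"
      using B that by (intro sum.cong) auto
    also have "\<dots> = chi v i"
      using that by (simp add: of_bool_def if_distrib[of "\<lambda>x. x * _"] cong: if_cong)
    finally show ?thesis by simp
  qed
  then have "Ker V chi' \<subseteq> Ker V chi"
    by (rule transform_Ker_subset[OF _ zero(1)])
  moreover have "Ker V chi \<subseteq> Ker V chi'"
    by (rule transform_Ker_subset[OF A(4) zero(2)])
  ultimately have "Ker V chi = Ker V chi'" by (rule equalityI[rotated])
  with A(1,2) show "chi \<in> char_maps V K n \<and> chi' \<in> char_maps V K n \<and> Ker V chi = Ker V chi'"
    by simp
next
  assume *: "chi \<in> char_maps V K n \<and> chi' \<in> char_maps V K n \<and> Ker V chi = Ker V chi'"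
  have ex_q: "\<exists>q. (\<forall>j v. v \<notin> \<sigma> \<longrightarrow> q j v = 0) \<and>
      (\<forall>j i. j < n \<longrightarrow> (\<Sum>u\<in>\<sigma>. q j u * chi u i) = of_bool (i = j))"
    if chi: "chi \<in> char_maps V K n" for chi
  proof -
    have "\<exists>c. (\<forall>v. v \<notin> \<sigma> \<longrightarrow> c v = 0) \<and> (j < n \<longrightarrow> (\<forall>i. (\<Sum>u\<in>\<sigma>. c u * chi u i) = of_bool (i = j)))" for j
    proof (cases "j < n")
      case True
      then have zero: "of_bool (i = j) = (0 :: bit)" if "n \<le> i" for i using that by simp
      obtain c where "\<And>v. v \<notin> \<sigma> \<Longrightarrow> c v = 0" "\<And>i. (\<Sum>v\<in>\<sigma>. c v * chi v i) = of_bool (i = j)"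
        using char_maps_spans[OF assms chi, of "\<lambda>i. of_bool (i = j)"] zero by blast
      then show ?thesis by (intro exI[of _ c]) simp
    next
      case False
      then show ?thesis by (intro exI[of _ "\<lambda>v. 0"]) simp
    qed
    then have "\<exists>q. \<forall>j. (\<forall>v. v \<notin> \<sigma> \<longrightarrow> q j v = 0) \<and>
        (j < n \<longrightarrow> (\<forall>i. (\<Sum>u\<in>\<sigma>. q j u * chi u i) = of_bool (i = j)))"
      by (intro choice allI)
    then show ?thesis by blast
  qed
  obtain q where q: "\<And>j v. v \<notin> \<sigma> \<Longrightarrow> q j v = 0"
      "\<And>j i. j < n \<Longrightarrow> (\<Sum>u\<in>\<sigma>. q j u * chi u i) = of_bool (i = j)"
    using ex_q[of chi] * by blast
  obtain q' where q': "\<And>j v. v \<notin> \<sigma> \<Longrightarrow> q' j v = 0"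
      "\<And>j i. j < n \<Longrightarrow> (\<Sum>u\<in>\<sigma>. q' j u * chi' u i) = of_bool (i = j)"
    using ex_q[of chi'] * by blast
  have zero: "chi v i = 0" "chi' v i = 0" if "n \<le> i" for v i
    using * that by (auto simp: char_maps_def)
  obtain A where A: "\<And>v i. v \<in> V \<Longrightarrow> chi' v i = (\<Sum>k<n. A i k * chi v k)"
    using Ker_subset_transform[OF assms(1,3) zero(1) q] * by blast
  obtain B where B: "\<And>v i. v \<in> V \<Longrightarrow> chi v i = (\<Sum>k<n. B i k * chi' v k)"
    using Ker_subset_transform[OF assms(1,3) zero(2) q'] * by blast
  note A' = A[OF subsetD[OF assms(3)]] and B' = B[OF subsetD[OF assms(3)]]
  have AB: "(\<Sum>k<n. B i k * A k j) = of_bool (i = j)" "(\<Sum>k<n. A i k * B k j) = of_bool (i = j)"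
    if "j < n" for i j
    using transform_compose[OF q(2) A' B' that] transform_compose[OF q'(2) B' A' that] by simp_all
  have "invertible_Z2 n A"
    unfolding invertible_Z2_def by (intro exI[of _ B]) (simp add: AB)
  then show "(chi, chi') \<in> DJ_rel V K n"
    using * A unfolding DJ_rel_def by blast
qed

lemma quotient_bij_image:
  "bij_betw (\<lambda>C. the_elem (f ` C)) (X // {(x, y). x \<in> X \<and> y \<in> X \<and> f x = f y}) (f ` X)"
proof -
  let ?r = "{(x, y). x \<in> X \<and> y \<in> X \<and> f x = f y}"
  have im: "f ` (?r `` {x}) = {f x}" if "x \<in> X" for x using that by auto
  show ?thesis
    unfolding bij_betw_def
  proof
    show "inj_on (\<lambda>C. the_elem (f ` C)) (X // ?r)"
    proof (rule inj_onI)
      fix C D assume CD: "C \<in> X // ?r" "D \<in> X // ?r" "the_elem (f ` C) = the_elem (f ` D)"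
      from CD(1) obtain x where x: "x \<in> X" "C = ?r `` {x}" by (rule quotientE)
      from CD(2) obtain y where y: "y \<in> X" "D = ?r `` {y}" by (rule quotientE)
      from CD(3) have "f x = f y" by (simp only: x(2) y(2) im[OF x(1)] im[OF y(1)] the_elem_eq)
      with x y show "C = D" by auto
    qed
    have "the_elem (f ` (?r `` {x})) = f x" if "x \<in> X" for x
      by (simp only: im[OF that] the_elem_eq)
    moreover have "X // ?r = (\<lambda>x. ?r `` {x}) ` X" by (auto simp: quotient_def)
    ultimately show "(\<lambda>C. the_elem (f ` C)) ` (X // ?r) = f ` X"
      by (simp only: image_image cong: image_cong)
  qed
qed

section \<open>The kernel attached to a partition and a sequence of e-sets\<close>

text \<open>The base coordinates range over all balanced vectors and determine the rest. Note the
  shift: the position \<open>(p, k)\<close> of the sequence governs the vertex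
  \<open>(p, Suc k)\<close>.\<close>

definition DJ_kernel ::
  "nat \<Rightarrow> (nat \<Rightarrow> nat) \<Rightarrow> nat set set \<Rightarrow> (nat \<times> nat \<Rightarrow> nat set) \<Rightarrow> (nat \<times> nat \<Rightarrow> bit) set" where
  "DJ_kernel m J \<Lambda> E = {c. (\<forall>v. v \<notin> verts_J m J \<longrightarrow> c v = 0) \<and> balanced m \<Lambda> (\<lambda>l. c (l, 0)) \<and>
    (\<forall>p k. (p, k) \<in> E_index m J \<longrightarrow>
      c (p, Suc k) = c (p, 0) + twist m \<Lambda> p (E (p, k)) (\<lambda>l. c (l, 0)))}"

lemma balanced_cong:
  assumes "\<And>l. l < m \<Longrightarrow> x l = y l"
  shows "balanced m \<Lambda> x \<longleftrightarrow> balanced m \<Lambda> y"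
proof -
  have "(\<Sum>l\<in>{..<m} - A. x l) = (\<Sum>l\<in>{..<m} - A. y l)" for A
    using assms by (intro sum.cong) auto
  then show ?thesis by (simp add: balanced_def)
qed

lemma twist_cong:
  assumes "\<And>l. l < m \<Longrightarrow> x l = y l"
  shows "twist m \<Lambda> p S x = twist m \<Lambda> p S y"
  unfolding twist_def using assms by (intro sum.cong) auto

lemma DJ_kernel_lift:
  assumes "\<forall>i<m. J i > 0" "balanced m \<Lambda> x"
  obtains c where "c \<in> DJ_kernel m J \<Lambda> E" "\<And>l. l < m \<Longrightarrow> c (l, 0) = x l"
proof -
  define c where "c = (\<lambda>(p, k). if (p, k) \<in> verts_J m J
    then (case k of 0 \<Rightarrow> x p | Suc k \<Rightarrow> x p + twist m \<Lambda> p (E (p, k)) x) else 0)"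
  have c0: "c (l, 0) = x l" if "l < m" for l
    using assms(1) that by (simp add: c_def verts_J_def)
  have "c (p, Suc k) = c (p, 0) + twist m \<Lambda> p (E (p, k)) (\<lambda>l. c (l, 0))"
    if "(p, k) \<in> E_index m J" for p k
  proof -
    have "p < m" "(p, Suc k) \<in> verts_J m J" using that by (auto simp: E_index_def verts_J_def)
    moreover have "twist m \<Lambda> p (E (p, k)) (\<lambda>l. c (l, 0)) = twist m \<Lambda> p (E (p, k)) x"
      by (rule twist_cong) (rule c0)
    ultimately show ?thesis using c0[of p] by (simp add: c_def)
  qed
  moreover have "balanced m \<Lambda> (\<lambda>l. c (l, 0))"
    using balanced_cong[of m "\<lambda>l. c (l, 0)" x] c0 assms(2) by blast
  moreover have "\<forall>v. v \<notin> verts_J m J \<longrightarrow> c v = 0" by (auto simp: c_def)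
  ultimately have "c \<in> DJ_kernel m J \<Lambda> E" by (simp add: DJ_kernel_def)
  with c0 show ?thesis by (rule that[rotated])
qed

lemma DJ_kernel_unique:
  assumes J: "\<forall>i<m. J i > 0" and c: "c \<in> DJ_kernel m J \<Lambda> E" and d: "d \<in> DJ_kernel m J \<Lambda> E"
    and cd: "\<And>l. l < m \<Longrightarrow> c (l, 0) = d (l, 0)"
  shows "c = d"
proof
  fix v
  show "c v = d v"
  proof (cases "v \<in> verts_J m J")
    case True
    then consider (base) l where "l < m" "v = (l, 0)"
      | (copy) p k where "(p, k) \<in> E_index m J" "v = (p, Suc k)"
      unfolding verts_J_eq[OF J] by auto
    then show ?thesis
    proof cases
      case copy
      then have "p < m" by (auto simp: E_index_def)
      have "twist m \<Lambda> p (E (p, k)) (\<lambda>l. c (l, 0)) = twist m \<Lambda> p (E (p, k)) (\<lambda>l. d (l, 0))"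
        by (rule twist_cong) (rule cd)
      with c d copy cd[OF \<open>p < m\<close>] show ?thesis by (simp add: DJ_kernel_def)
    qed (simp add: cd)
  next
    case False
    then have "c v = 0" "d v = 0" using c d unfolding DJ_kernel_def by blast+
    then show ?thesis by simp
  qed
qed

lemma DJ_kernel_zero: "(\<lambda>v. 0) \<in> DJ_kernel m J \<Lambda> E"
  by (simp add: DJ_kernel_def balanced_def twist_def)

lemma DJ_kernel_face_eq_0:
  assumes m: "m \<ge> 3" and J: "\<forall>i<m. J i > 0" and E: "(\<Lambda>, E) \<in> DJ_mJ m J"
    and c: "c \<in> DJ_kernel m J \<Lambda> E" and s: "\<sigma> \<in> faces_PJ m J" "\<And>v. v \<notin> \<sigma> \<Longrightarrow> c v = 0"
  shows "c = (\<lambda>v. 0)"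
proof -
  have L: "\<Lambda> \<in> DJ_P m"
    and compat: "\<And>p k. (p, k) \<in> E_index m J \<Longrightarrow> eset_compat m \<Lambda> p (E (p, k))"
    and rel: "\<And>p k q l. (p, k) \<in> E_index m J \<Longrightarrow> (q, l) \<in> E_index m J \<Longrightarrow> (p, k) \<noteq> (q, l) \<Longrightarrow>
      lam_related m \<Lambda> (p, E (p, k)) (q, E (q, l))"
    using E by (fastforce simp: DJ_mJ_def)+
  obtain i where i: "i < m" "\<forall>j<m. j \<noteq> i \<longrightarrow> j \<noteq> Suc i mod m \<longrightarrow> (\<exists>k<J j. (j, k) \<notin> \<sigma>)"
    using s(1) unfolding faces_PJ_iff[OF m] by blast
  have "\<forall>j. \<exists>k. j < m \<longrightarrow> k < J j \<and> (j \<noteq> i \<longrightarrow> j \<noteq> Suc i mod m \<longrightarrow> (j, k) \<notin> \<sigma>)"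
    using i(2) J by metis
  then obtain f where f: "\<And>j. j < m \<Longrightarrow> f j < J j"
      "\<And>j. j < m \<Longrightarrow> j \<noteq> i \<Longrightarrow> j \<noteq> Suc i mod m \<Longrightarrow> (j, f j) \<notin> \<sigma>"
    by metis
  \<comment> \<open>A missing base vertex is treated like a copy with empty e-set: its twist is zero
    and it is related to everything, so both cases satisfy the same equation
    \<open>x j = twist m \<Lambda> j (T j) x\<close>.\<close>
  define T where "T j = (case f j of 0 \<Rightarrow> {} | Suc k \<Rightarrow> E (j, k))" for j
  have idx: "(j, k) \<in> E_index m J" if "j < m" "f j = Suc k" for j k
    using f(1)[OF that(1)] that by (simp add: E_index_def)
  define x where "x = (\<lambda>l. c (l, 0))"
  have x: "balanced m \<Lambda> x" using c by (simp add: DJ_kernel_def x_def)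
  have "x l = 0" if "l < m" for l
  proof (rule related_balanced_eq_0[OF L i(1) x _ _ _ that, where T = T])
    show "eset_compat m \<Lambda> j (T j)" if "j < m" for j
      using eset_empty[OF L that] compat idx[OF that] by (simp add: T_def split: nat.split)
    show "lam_related m \<Lambda> (j, T j) (l, T l)" if "j < m" "l < m" "j \<noteq> l" for j l
    proof (cases "f j = 0 \<or> f l = 0")
      case True
      then have "T j = {} \<or> T l = {}" by (auto simp: T_def)
      then show ?thesis by (auto simp: lam_related_def)
    next
      case False
      then obtain a b where ab: "f j = Suc a" "f l = Suc b" by (metis not0_implies_Suc)
      with rel[OF idx[OF that(1)] idx[OF that(2)]] that(3) show ?thesis by (simp add: T_def)
    qed
    show "x j = twist m \<Lambda> j (T j) x" if j: "j < m" "j \<noteq> i" "j \<noteq> Suc i mod m" for j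
    proof -
      have z: "c (j, f j) = 0" using f(2)[OF j] s(2) by blast
      show ?thesis
      proof (cases "f j")
        case 0
        with z show ?thesis by (simp add: x_def T_def)
      next
        case (Suc k)
        then have "c (j, Suc k) = x j + twist m \<Lambda> j (E (j, k)) x"
          using c idx[OF j(1) Suc] by (simp add: DJ_kernel_def x_def)
        with z Suc show ?thesis by (simp add: T_def)
      qed
    qed
  qed
  then show ?thesis
    by (intro DJ_kernel_unique[OF J c DJ_kernel_zero]) (simp add: x_def)
qed

text \<open>With the colouring normalised to vanish at the gap \<open>i\<close>, both ends of the
  edge drop out, \<open>p\<close> lies in its own part, and only \<open>q\<close>
  contributes.\<close>

lemma twist_edge:
  assumes L: "\<Lambda> \<in> DJ_P m" and x: "balanced m \<Lambda> x" and S: "eset_compat m \<Lambda> p S"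
    and pq: "p < m" "q < m" "\<not> lam_equiv \<Lambda> p q" "x q = 1" and i: "i < m"
    and supp: "\<And>l. l < m \<Longrightarrow> x l = 1 \<Longrightarrow> l \<in> {p, q, i, Suc i mod m}"
  shows "twist m \<Lambda> p S x = side S q + side S (Suc i)"
proof -
  have "(side S l + side S (Suc i)) * x l = 0" if l: "l < m" "\<not> lam_equiv \<Lambda> p l" "l \<noteq> q" for l
  proof (cases "x l = 1")
    case True
    then consider "l = p" | "l = i" | "l = Suc i mod m" using supp l by blast
    then have "side S l = side S (Suc i)"
    proof cases
      case 1 then show ?thesis using l(2) lam_equiv_refl[OF L pq(1)] by simp
    next
      case 2 then show ?thesis using side_Suc_notin[OF eset_notin[OF S l(2)]] by simp
    next
      case 3 then show ?thesis using side_Suc_mod[OF eset_side[OF S] i] by simp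
    qed
    then show ?thesis by simp
  qed simp
  then have "(\<Sum>l | l < m \<and> \<not> lam_equiv \<Lambda> p l. (side S l + side S (Suc i)) * x l) =
      (\<Sum>l\<in>{q}. (side S l + side S (Suc i)) * x l)"
    using pq by (intro sum.mono_neutral_right) auto
  with twist_shift[OF L x pq(1)] pq(4) show ?thesis by simp
qed

text \<open>A gap shared by two \<open>Omega\<close> sets yields a forbidden relation: add the
  relations that express \<open>p\<close> and \<open>q\<close> through the edge at this gap. Both
  twists are then \<open>1\<close> and cancel the base coordinates, so the two copies get
  coefficient zero and the support is a face.\<close>

lemma related_if_DJ_kernel_face_eq_0:
  assumes m: "m \<ge> 3" and J: "\<forall>i<m. J i > 0" and L: "\<Lambda> \<in> DJ_P m"
    and compat: "\<And>p k. (p, k) \<in> E_index m J \<Longrightarrow> eset_compat m \<Lambda> p (E (p, k))"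
    and faces: "\<And>c \<sigma>. c \<in> DJ_kernel m J \<Lambda> E \<Longrightarrow> \<sigma> \<in> faces_PJ m J \<Longrightarrow> \<forall>v. v \<notin> \<sigma> \<longrightarrow> c v = 0 \<Longrightarrow>
      c = (\<lambda>v. 0)"
    and pk: "(p, k) \<in> E_index m J" and ql: "(q, l) \<in> E_index m J"
  shows "lam_related m \<Lambda> (p, E (p, k)) (q, E (q, l))"
proof (rule ccontr)
  let ?S = "E (p, k)" and ?T = "E (q, l)"
  note S = compat[OF pk] and T = compat[OF ql]
  assume "\<not> lam_related m \<Lambda> (p, ?S) (q, ?T)"
  then obtain i where ne: "\<not> lam_equiv \<Lambda> p q" and i: "i < m"
      "side ?S (Suc i) \<noteq> side ?S q" "side ?T (Suc i) \<noteq> side ?T p"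
    unfolding lam_related_iff[OF L S T] by blast
  have ne': "\<not> lam_equiv \<Lambda> q p" using ne by (simp add: lam_equiv_commute)
  have lt: "p < m" "q < m" using pk ql by (auto simp: E_index_def)
  have pq: "p \<noteq> q" using ne lam_equiv_refl[OF L lt(1)] by auto
  \<comment> \<open>The ends of the edge lie on the same side as the gap \<open>i\<close> whenever
    they are not cut points, whereas \<open>?T\<close> separates \<open>p\<close> from this
    gap.\<close>
  have p: "p \<noteq> i" "p \<noteq> Suc i mod m"
    using i(3) side_Suc_notin[OF eset_notin[OF T ne']] side_Suc_mod[OF eset_side[OF T] i(1)] by auto
  have q: "q \<noteq> i" "q \<noteq> Suc i mod m"
    using i(2) side_Suc_notin[OF eset_notin[OF S ne]] side_Suc_mod[OF eset_side[OF S] i(1)] by auto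
  obtain Y where Y: "p \<in> Y" "Y \<subseteq> {p, i, Suc i mod m}" "balanced m \<Lambda> (\<lambda>l. of_bool (l \<in> Y))"
    using balanced_edge[OF L i(1) lt(1) p] by blast
  obtain Z where Z: "q \<in> Z" "Z \<subseteq> {q, i, Suc i mod m}" "balanced m \<Lambda> (\<lambda>l. of_bool (l \<in> Z))"
    using balanced_edge[OF L i(1) lt(2) q] by blast
  define x :: "nat \<Rightarrow> bit" where "x l = of_bool (l \<in> Y) + of_bool (l \<in> Z)" for l
  have x: "balanced m \<Lambda> x" unfolding x_def by (rule balanced_add[OF Y(3) Z(3)])
  have xpq: "x p = 1" "x q = 1" using Y Z pq p q by (auto simp: x_def)
  have supp: "h \<in> {p, q, i, Suc i mod m}" if "x h = 1" for h
  proof -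
    have "h \<in> Y \<union> Z" using that by (auto simp: x_def)
    with Y(2) Z(2) show ?thesis by blast
  qed
  obtain c where c: "c \<in> DJ_kernel m J \<Lambda> E" and c0: "\<And>h. h < m \<Longrightarrow> c (h, 0) = x h"
    using DJ_kernel_lift[OF J x] by blast
  have tw: "twist m \<Lambda> r R (\<lambda>h. c (h, 0)) = twist m \<Lambda> r R x" for r R
    by (rule twist_cong) (rule c0)
  have "c (p, Suc k) = x p + (side ?S q + side ?S (Suc i))"
    using c pk tw twist_edge[OF L x S lt ne xpq(2) i(1)] supp c0[OF lt(1)] by (auto simp: DJ_kernel_def)
  then have cp: "c (p, Suc k) = 0" using xpq(1) i(2) by simp
  have "c (q, Suc l) = x q + (side ?T p + side ?T (Suc i))"
    using c ql tw twist_edge[OF L x T lt(2,1) ne' xpq(1) i(1)] supp c0[OF lt(2)] by (auto simp: DJ_kernel_def)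
  then have cq: "c (q, Suc l) = 0" using xpq(2) i(3) by simp
  \<comment> \<open>Off the edge the support misses the copy \<open>(p, Suc k)\<close>, the copy
    \<open>(q, Suc l)\<close>, and the base vertex of every other fibre.\<close>
  define \<sigma> where "\<sigma> = {v. c v = 1}"
  have "\<exists>k<J j. (j, k) \<notin> \<sigma>" if j: "j < m" "j \<noteq> i" "j \<noteq> Suc i mod m" for j
  proof -
    consider "j = p" | "j = q" | "x j = 0" using supp[of j] j by (cases "x j = 1") auto
    then show ?thesis
    proof cases
      case 1 with cp pk show ?thesis by (intro exI[of _ "Suc k"]) (auto simp: \<sigma>_def E_index_def)
    next
      case 2 with cq ql show ?thesis by (intro exI[of _ "Suc l"]) (auto simp: \<sigma>_def E_index_def)
    next
      case 3 with c0[OF j(1)] J j(1) show ?thesis by (intro exI[of _ 0]) (auto simp: \<sigma>_def)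
    qed
  qed
  moreover have "\<sigma> \<subseteq> verts_J m J"
  proof
    fix v assume "v \<in> \<sigma>"
    then have "c v \<noteq> 0" by (simp add: \<sigma>_def)
    with c show "v \<in> verts_J m J" unfolding DJ_kernel_def by blast
  qed
  ultimately have "\<sigma> \<in> faces_PJ m J"
    unfolding faces_PJ_iff[OF m] using i(1) by blast
  then have "c = (\<lambda>v. 0)" using faces[OF c] by (simp add: \<sigma>_def)
  with c0[OF lt(1)] xpq(1) show False by simp
qed

section \<open>A characteristic map with prescribed kernel\<close>

lemma sum_verts_J:
  assumes "\<forall>i<m. J i > 0"
  shows "(\<Sum>v\<in>verts_J m J. f v) = (\<Sum>l<m. f (l, 0)) + (\<Sum>(p, k)\<in>E_index m J. f (p, Suc k))"
proof -
  have "(\<Sum>v\<in>verts_J m J. f v) = (\<Sum>v\<in>(\<lambda>(i, k). (i, Suc k)) ` E_index m J. f v) + (\<Sum>v\<in>(\<lambda>i. (i, 0)) ` {..<m}. f v)"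
    unfolding verts_J_eq[OF assms] by (rule sum.union_disjoint) (auto simp: finite_E_index)
  also have "(\<Sum>v\<in>(\<lambda>(i, k). (i, Suc k)) ` E_index m J. f v) = (\<Sum>(p, k)\<in>E_index m J. f (p, Suc k))"
    by (subst sum.reindex) (auto simp: inj_on_def case_prod_unfold)
  also have "(\<Sum>v\<in>(\<lambda>i. (i, 0)) ` {..<m}. f v) = (\<Sum>l<m. f (l, 0))"
    by (subst sum.reindex) (auto simp: inj_on_def)
  finally show ?thesis by (simp add: add.commute)
qed

text \<open>Every point lies outside exactly two of the three parts, so the three conditions add up
  to zero modulo 2. Two equations remain, which gives the summand \<open>2\<close> in the
  dimension.\<close>

lemma balanced_two_parts:
  assumes L: "\<Lambda> \<in> DJ_P m"
  obtains A B where "\<And>x. balanced m \<Lambda> x \<longleftrightarrow>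
    (\<Sum>l\<in>{..<m} - A. x l) = 0 \<and> (\<Sum>l\<in>{..<m} - B. x l) = 0"
proof -
  have "card \<Lambda> = 3" using L by (simp add: DJ_P_def)
  then obtain A B C where ABC: "\<Lambda> = {A, B, C}" "A \<noteq> B" "A \<noteq> C" "B \<noteq> C"
    by (auto simp: card_3_iff)
  have one: "of_bool (l \<notin> A) + of_bool (l \<notin> B) = (of_bool (l \<notin> C) :: bit)" if l: "l < m" for l
  proof -
    obtain P where P: "P \<in> \<Lambda>" "l \<in> P" using DJ_P_part[OF L l] by blast
    then have "Q \<in> \<Lambda> \<Longrightarrow> l \<in> Q \<longleftrightarrow> Q = P" for Q using DJ_P_disjoint[OF L] by blast
    then have "l \<in> A \<longleftrightarrow> A = P" "l \<in> B \<longleftrightarrow> B = P" "l \<in> C \<longleftrightarrow> C = P" using ABC(1) by simp_all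
    with P(1) ABC show ?thesis by auto
  qed
  have ind: "(\<Sum>l\<in>{..<m} - P. x l) = (\<Sum>l<m. of_bool (l \<notin> P) * x l)" for P and x :: "nat \<Rightarrow> bit"
    by (rule sum.mono_neutral_cong_left) auto
  have "(\<Sum>l\<in>{..<m} - A. x l) + (\<Sum>l\<in>{..<m} - B. x l) = (\<Sum>l\<in>{..<m} - C. x l)" for x :: "nat \<Rightarrow> bit"
    unfolding ind sum.distrib[symmetric] distrib_right[symmetric]
    using one by (intro sum.cong) auto
  then have "balanced m \<Lambda> x \<longleftrightarrow> (\<Sum>l\<in>{..<m} - A. x l) = 0 \<and> (\<Sum>l\<in>{..<m} - B. x l) = 0" for x
    unfolding balanced_def ABC(1) by (metis add_0 insert_iff empty_iff)
  then show ?thesis by (rule that)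
qed

lemma DJ_kernel_realised:
  assumes m: "m \<ge> 3" and J: "\<forall>i<m. J i > 0" and E: "(\<Lambda>, E) \<in> DJ_mJ m J"
  obtains chi where "chi \<in> char_maps (verts_J m J) (faces_PJ m J) (card (E_index m J) + 2)"
    "Ker (verts_J m J) chi = DJ_kernel m J \<Lambda> E"
proof -
  let ?V = "verts_J m J"
  have L: "\<Lambda> \<in> DJ_P m" using E by (simp add: DJ_mJ_def)
  define N where "N = card (E_index m J)"
  obtain h where h: "bij_betw h {0..<N} (E_index m J)"
    using ex_bij_betw_nat_finite[OF finite_E_index] by (auto simp: N_def)
  obtain A B where AB: "\<And>x. balanced m \<Lambda> x \<longleftrightarrow>
      (\<Sum>l\<in>{..<m} - A. x l) = 0 \<and> (\<Sum>l\<in>{..<m} - B. x l) = 0"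
    using balanced_two_parts[OF L] by blast
  \<comment> \<open>The coefficients of the equation for the copy \<open>(p, Suc k)\<close>, with
    all terms on one side. These rows and the two partition equations fill the coordinates of
    \<open>chi\<close>, so that \<open>Ker\<close> is the solution space.\<close>
  define row :: "nat \<times> nat \<Rightarrow> nat \<times> nat \<Rightarrow> bit" where
    "row = (\<lambda>(p, k) (l, j). case j of
      0 \<Rightarrow> of_bool (l = p) + of_bool (\<not> lam_equiv \<Lambda> p l) * side (E (p, k)) l
    | Suc j \<Rightarrow> of_bool ((l, j) = (p, k)))"
  define chi where "chi v i = (if v \<notin> ?V then 0 else if i < N then row (h i) v
    else if i = N then of_bool (snd v = 0 \<and> fst v \<notin> A)
    else if i = Suc N then of_bool (snd v = 0 \<and> fst v \<notin> B) else 0)" for v i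
  have sum_row: "(\<Sum>v\<in>?V. c v * row (p, k) v) =
      c (p, 0) + twist m \<Lambda> p (E (p, k)) (\<lambda>l. c (l, 0)) + c (p, Suc k)"
    if pk: "(p, k) \<in> E_index m J" for c p k
  proof -
    have p: "p < m" using pk by (simp add: E_index_def)
    have "(\<Sum>l<m. c (l, 0) * row (p, k) (l, 0)) =
        (\<Sum>l<m. c (l, 0) * of_bool (l = p)) +
        (\<Sum>l<m. of_bool (\<not> lam_equiv \<Lambda> p l) * (side (E (p, k)) l * c (l, 0)))"
      by (simp add: row_def distrib_left sum.distrib mult_ac)
    also have "(\<Sum>l<m. c (l, 0) * of_bool (l = p)) = c (p, 0)"
      using p by (simp add: of_bool_def if_distrib[of "\<lambda>x. _ * x"] cong: if_cong)
    also have "(\<Sum>l<m. of_bool (\<not> lam_equiv \<Lambda> p l) * (side (E (p, k)) l * c (l, 0))) =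
        twist m \<Lambda> p (E (p, k)) (\<lambda>l. c (l, 0))"
      unfolding twist_def by (rule sum.mono_neutral_cong_right) auto
    finally have base: "(\<Sum>l<m. c (l, 0) * row (p, k) (l, 0)) =
        c (p, 0) + twist m \<Lambda> p (E (p, k)) (\<lambda>l. c (l, 0))" .
    have "(\<Sum>(q, j)\<in>E_index m J. c (q, Suc j) * row (p, k) (q, Suc j)) =
        (\<Sum>v\<in>E_index m J. if v = (p, k) then c (p, Suc k) else 0)"
      by (rule sum.cong) (auto simp: row_def)
    also have "\<dots> = c (p, Suc k)"
      using pk finite_E_index by simp
    finally show ?thesis
      unfolding sum_verts_J[OF J] base by simp
  qed
  have sum_part: "(\<Sum>v\<in>?V. c v * of_bool (snd v = 0 \<and> fst v \<notin> P)) = (\<Sum>l\<in>{..<m} - P. c (l, 0))"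
    for c :: "nat \<times> nat \<Rightarrow> bit" and P
  proof -
    have "(\<Sum>l<m. c (l, 0) * of_bool (l \<notin> P)) = (\<Sum>l\<in>{..<m} - P. c (l, 0))"
      by (rule sum.mono_neutral_cong_right) auto
    then show ?thesis unfolding sum_verts_J[OF J] by simp
  qed
  have chi_sum: "(\<Sum>v\<in>?V. c v * chi v i) = (if i < N then (\<Sum>v\<in>?V. c v * row (h i) v)
      else if i = N then (\<Sum>l\<in>{..<m} - A. c (l, 0))
      else if i = Suc N then (\<Sum>l\<in>{..<m} - B. c (l, 0)) else 0)" for c i
    unfolding sum_part[symmetric] by (auto simp: chi_def intro!: sum.cong)
  have ker: "Ker ?V chi = DJ_kernel m J \<Lambda> E"
  proof (intro set_eqI)
    fix c
    have "(\<forall>i. (\<Sum>v\<in>?V. c v * chi v i) = 0) \<longleftrightarrow>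
        (\<forall>i<N. (\<Sum>v\<in>?V. c v * row (h i) v) = 0) \<and> balanced m \<Lambda> (\<lambda>l. c (l, 0))"
      (is "?L \<longleftrightarrow> ?R")
    proof
      assume L: ?L
      have "(\<Sum>v\<in>?V. c v * row (h i) v) = 0" if "i < N" for i
        using L[rule_format, of i] that by (simp add: chi_sum)
      moreover have "balanced m \<Lambda> (\<lambda>l. c (l, 0))"
        using L[rule_format, of N] L[rule_format, of "Suc N"] by (simp add: chi_sum AB)
      ultimately show ?R by blast
    next
      assume ?R
      then show ?L by (simp add: chi_sum AB)
    qed
    also have "(\<forall>i<N. (\<Sum>v\<in>?V. c v * row (h i) v) = 0) \<longleftrightarrow>
        (\<forall>e\<in>E_index m J. (\<Sum>v\<in>?V. c v * row e v) = 0)"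
      unfolding bij_betw_imp_surj_on[OF h, symmetric] ball_simps atLeast0LessThan lessThan_iff by blast
    also have "\<dots> \<longleftrightarrow> (\<forall>p k. (p, k) \<in> E_index m J \<longrightarrow>
        c (p, Suc k) = c (p, 0) + twist m \<Lambda> p (E (p, k)) (\<lambda>l. c (l, 0)))"
    proof -
      have "(\<Sum>v\<in>?V. c v * row (p, k) v) = 0 \<longleftrightarrow>
          c (p, Suc k) = c (p, 0) + twist m \<Lambda> p (E (p, k)) (\<lambda>l. c (l, 0))"
        if "(p, k) \<in> E_index m J" for p k
        unfolding sum_row[OF that] bit_add_eq_0_iff by (rule eq_commute)
      then show ?thesis by (simp add: Ball_def)
    qed
    finally show "c \<in> Ker ?V chi \<longleftrightarrow> c \<in> DJ_kernel m J \<Lambda> E"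
      unfolding Ker_def DJ_kernel_def mem_Collect_eq by blast
  qed
  have "chi \<in> char_maps ?V (faces_PJ m J) (N + 2)"
  proof (subst char_maps_iff_Ker[OF finite_verts_J], goal_cases)
    case 2
    have "c = (\<lambda>v. 0)" if "\<sigma> \<in> faces_PJ m J" "c \<in> Ker ?V chi" "\<forall>v. v \<notin> \<sigma> \<longrightarrow> c v = 0" for \<sigma> c
      using DJ_kernel_face_eq_0[OF m J E _ that(1)] that(2,3) unfolding ker by blast
    then show ?case by (auto simp: chi_def)
  qed (simp add: faces_PJ_def)
  with ker show ?thesis using that by (simp add: N_def)
qed

section \<open>Recovering the partition and the e-sets from the kernel\<close>

lemma lam_equiv_iff_balanced:
  assumes L: "\<Lambda> \<in> DJ_P m" and "p < m" "q < m" "p \<noteq> q"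
  shows "lam_equiv \<Lambda> p q \<longleftrightarrow> balanced m \<Lambda> (\<lambda>l. of_bool (l \<in> {p, q}))"
proof
  assume x: "balanced m \<Lambda> (\<lambda>l. of_bool (l \<in> {p, q}))"
  show "lam_equiv \<Lambda> p q"
  proof (rule ccontr)
    assume ne: "\<not> lam_equiv \<Lambda> p q"
    have "(\<Sum>l | l < m \<and> \<not> lam_equiv \<Lambda> p l. of_bool (l \<in> {p, q})) = (\<Sum>l\<in>{q}. 1 :: bit)"
      by (rule sum.mono_neutral_cong_right) (use assms ne lam_equiv_refl[OF L] in auto)
    with balanced_sum[OF L x assms(2)] show False by simp
  qed
qed (rule balanced_pair[OF assms])

text \<open>The neighbours \<open>a\<close> and \<open>b\<close> of \<open>s\<close> lie outside the
  part of \<open>p\<close>, and their sides differ exactly if \<open>s\<close> is a cut point. If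
  \<open>a\<close> and \<open>b\<close> are inequivalent, \<open>s\<close> is added to
  \<open>Y\<close> for balance; this does not affect the twist, since \<open>s\<close> is in the
  part of \<open>p\<close>.\<close>

lemma ex_detecting_vector:
  assumes L: "\<Lambda> \<in> DJ_P m" and m: "m \<ge> 3" and s: "s < m" "lam_equiv \<Lambda> p s" and p: "p < m"
  obtains x where "balanced m \<Lambda> x"
    "\<And>S. eset_compat m \<Lambda> p S \<Longrightarrow> twist m \<Lambda> p S x = of_bool (s \<in> S)"
proof -
  obtain a where a: "a < m" "Suc a mod m = s" by (rule ex_cyclic_pred[OF s(1)])
  define b where "b = Suc s mod m"
  have b: "b < m" using s by (simp add: b_def)
  have "a \<noteq> b"
    using a m unfolding b_def by (cases "Suc a = m"; cases "Suc s = m") auto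
  have as: "\<not> lam_equiv \<Lambda> a s" using not_lam_equiv_Suc[OF L a(1)] a(2) by simp
  have sb: "\<not> lam_equiv \<Lambda> s b" using not_lam_equiv_Suc[OF L s(1)] by (simp add: b_def)
  have pa: "\<not> lam_equiv \<Lambda> p a"
    using as s(2) lam_equiv_trans[OF L] lam_equiv_sym by blast
  have pb: "\<not> lam_equiv \<Lambda> p b"
    using sb s(2) lam_equiv_trans[OF L] lam_equiv_sym by blast
  define Y where "Y = (if lam_equiv \<Lambda> a b then {a, b} else {a, s, b})"
  have "balanced m \<Lambda> (\<lambda>l. of_bool (l \<in> Y))"
    using balanced_pair[OF L a(1) b \<open>a \<noteq> b\<close>] balanced_triple[OF L a(1) s(1) b as _ sb]
    by (simp add: Y_def)
  moreover have "twist m \<Lambda> p S (\<lambda>l. of_bool (l \<in> Y)) = of_bool (s \<in> S)"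
    if S: "eset_compat m \<Lambda> p S" for S
  proof -
    have "twist m \<Lambda> p S (\<lambda>l. of_bool (l \<in> Y)) = (\<Sum>l\<in>{a, b}. side S l)"
      unfolding twist_def
      by (rule sum.mono_neutral_cong_right) (use a(1) b pa pb s(2) in \<open>auto simp: Y_def\<close>)
    also have "\<dots> = side S a + side S b" using \<open>a \<noteq> b\<close> by simp
    also have "side S a = side S s"
      using side_Suc_notin[OF eset_notin[OF S pa]] side_Suc_mod[OF eset_side[OF S] a(1)] a(2) by simp
    also have "side S b = side S (Suc s)"
      unfolding b_def by (rule side_Suc_mod[OF eset_side[OF S] s(1)])
    finally show ?thesis by (simp add: side_Suc)
  qed
  ultimately show ?thesis by (rule that)
qed

lemma DJ_P_nonempty_parts_subset:
  assumes L: "\<Lambda> \<in> DJ_P m" and L': "\<Lambda>' \<in> DJ_P m"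
    and eq: "\<And>p q. p < m \<Longrightarrow> q < m \<Longrightarrow> lam_equiv \<Lambda> p q \<longleftrightarrow> lam_equiv \<Lambda>' p q"
  shows "\<Lambda> - {{}} \<subseteq> \<Lambda>'"
proof
  fix A assume A: "A \<in> \<Lambda> - {{}}"
  then obtain p where p: "p \<in> A" by blast
  then have "p < m" using A DJ_P_subset[OF L, of A] by blast
  then obtain B where B: "B \<in> \<Lambda>'" "p \<in> B" by (rule DJ_P_part[OF L'])
  have "l \<in> A \<longleftrightarrow> l \<in> B" if "l < m" for l
    using eq[OF \<open>p < m\<close> that] lam_equiv_part[OF L _ p] lam_equiv_part[OF L' B] A by simp
  then have "A = B"
    using DJ_P_subset[OF L, of A] DJ_P_subset[OF L' B(1)] A by blast
  with B(1) show "A \<in> \<Lambda>'" by simp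
qed

text \<open>The equivalence determines the nonempty parts only; whether the empty set is a part
  follows from the number of parts being three.\<close>

lemma DJ_P_eqI:
  assumes L: "\<Lambda> \<in> DJ_P m" and L': "\<Lambda>' \<in> DJ_P m"
    and eq: "\<And>p q. p < m \<Longrightarrow> q < m \<Longrightarrow> lam_equiv \<Lambda> p q \<longleftrightarrow> lam_equiv \<Lambda>' p q"
  shows "\<Lambda> = \<Lambda>'"
proof -
  have "\<Lambda> - {{}} \<subseteq> \<Lambda>'" "\<Lambda>' - {{}} \<subseteq> \<Lambda>"
    using DJ_P_nonempty_parts_subset[OF L L' eq] DJ_P_nonempty_parts_subset[OF L' L] eq by simp_all
  then have ne: "\<Lambda> - {{}} = \<Lambda>' - {{}}" by blast
  have c: "card \<Lambda> = 3" "card \<Lambda>' = 3" using L L' by (auto simp: DJ_P_def)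
  then have "finite \<Lambda>" "finite \<Lambda>'" by (auto intro: card_ge_0_finite)
  then have "{} \<in> \<Lambda> \<longleftrightarrow> {} \<in> \<Lambda>'"
    using c ne card_Diff_singleton_if[of \<Lambda> "{}"] card_Diff_singleton_if[of \<Lambda>' "{}"]
    by (auto split: if_splits)
  with ne show ?thesis by blast
qed

lemma DJ_kernel_inj:
  assumes m: "m \<ge> 3" and J: "\<forall>i<m. J i > 0"
    and E: "(\<Lambda>, E) \<in> DJ_mJ m J" and E': "(\<Lambda>', E') \<in> DJ_mJ m J"
    and eq: "DJ_kernel m J \<Lambda> E = DJ_kernel m J \<Lambda>' E'"
  shows "\<Lambda> = \<Lambda>' \<and> E = E'"
proof -
  have L: "\<Lambda> \<in> DJ_P m" and L': "\<Lambda>' \<in> DJ_P m" using E E' by (auto simp: DJ_mJ_def)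
  have sub: "balanced m M' x" if M: "DJ_kernel m J M F = DJ_kernel m J M' F'" "balanced m M x" for M M' F F' x
  proof -
    obtain c where c: "c \<in> DJ_kernel m J M F" "\<And>l. l < m \<Longrightarrow> c (l, 0) = x l"
      using DJ_kernel_lift[OF J M(2)] by blast
    from c(1) have "c \<in> DJ_kernel m J M' F'" unfolding M(1) .
    then have "balanced m M' (\<lambda>l. c (l, 0))" by (simp add: DJ_kernel_def)
    then show ?thesis using balanced_cong[of m "\<lambda>l. c (l, 0)" x] c(2) by blast
  qed
  have "lam_equiv \<Lambda> p q \<longleftrightarrow> lam_equiv \<Lambda>' p q" if "p < m" "q < m" for p q
  proof (cases "p = q")
    case True
    then show ?thesis using lam_equiv_refl[OF L that(1)] lam_equiv_refl[OF L' that(1)] by simp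
  next
    case False
    then show ?thesis
      unfolding lam_equiv_iff_balanced[OF L that False] lam_equiv_iff_balanced[OF L' that False]
      using sub[OF eq] sub[OF eq[symmetric]] by blast
  qed
  then have LL: "\<Lambda> = \<Lambda>'" by (rule DJ_P_eqI[OF L L'])
  have "E e = E' e" for e
  proof (cases "e \<in> E_index m J")
    case True
    obtain p k where e: "e = (p, k)" by (cases e)
    have p: "p < m" using True by (simp add: e E_index_def)
    have compat: "eset_compat m \<Lambda> p (E e)" "eset_compat m \<Lambda> p (E' e)"
      using E E' True by (auto simp: DJ_mJ_def e LL)
    have "s \<in> E e \<longleftrightarrow> s \<in> E' e" for s
    proof (cases "s < m \<and> lam_equiv \<Lambda> p s")
      case True
      then obtain x where x: "balanced m \<Lambda> x"
          "\<And>S. eset_compat m \<Lambda> p S \<Longrightarrow> twist m \<Lambda> p S x = of_bool (s \<in> S)"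
        using ex_detecting_vector[OF L m _ _ p] by blast
      obtain c where c: "c \<in> DJ_kernel m J \<Lambda> E" "\<And>l. l < m \<Longrightarrow> c (l, 0) = x l"
        using DJ_kernel_lift[OF J x(1)] by blast
      have "c \<in> DJ_kernel m J \<Lambda> E'" using c(1) eq LL by simp
      with c(1) \<open>e \<in> E_index m J\<close>
      have "twist m \<Lambda> p (E e) (\<lambda>l. c (l, 0)) = twist m \<Lambda> p (E' e) (\<lambda>l. c (l, 0))"
        by (simp add: DJ_kernel_def e)
      then have "twist m \<Lambda> p (E e) x = twist m \<Lambda> p (E' e) x"
        using twist_cong[of m "\<lambda>l. c (l, 0)" x] c(2) by simp
      then have "of_bool (s \<in> E e) = (of_bool (s \<in> E' e) :: bit)"
        using x(2)[OF compat(1)] x(2)[OF compat(2)] by simp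
      then show ?thesis by (simp add: of_bool_eq_iff)
    next
      case False
      moreover have "s < m" if "eset_compat m \<Lambda> p S" "s \<in> S" for S
        using that by (auto simp: eset_compat_def)
      ultimately have "s \<notin> S" if "eset_compat m \<Lambda> p S" for S
        using eset_equiv[OF that] that by blast
      with compat show ?thesis by blast
    qed
    then show ?thesis by blast
  next
    case False
    with E E' show ?thesis by (cases e) (simp add: DJ_mJ_def)
  qed
  with LL show ?thesis by blast
qed

section \<open>Every kernel comes from a partition and e-sets\<close>

lemma Ker_add:
  assumes "c \<in> Ker V chi" "d \<in> Ker V chi"
  shows "(\<lambda>v. c v + d v) \<in> Ker V chi"
  using assms by (simp add: Ker_def distrib_right sum.distrib)

lemma Ker_combination:
  assumes "\<And>j. j \<in> I \<Longrightarrow> u j \<in> Ker V chi"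
  shows "(\<lambda>v. \<Sum>j\<in>I. x j * u j v) \<in> Ker V chi"
proof -
  have "(\<Sum>v\<in>V. (\<Sum>j\<in>I. x j * u j v) * chi v i) = (\<Sum>j\<in>I. x j * (\<Sum>v\<in>V. u j v * chi v i))" for i
    by (simp add: sum_distrib_left sum_distrib_right mult.assoc) (rule sum.swap)
  then show ?thesis
    using assms by (auto simp: Ker_def)
qed

lemma sum_of_bool_mult:
  fixes f :: "nat \<Rightarrow> bit"
  assumes "Y \<subseteq> {..<m}"
  shows "(\<Sum>l<m. f l * of_bool (l \<in> Y)) = (\<Sum>l\<in>Y. f l)"
  by (rule sum.mono_neutral_cong_right) (use assms in auto)

lemma sum_split_two:
  fixes f :: "nat \<Rightarrow> bit"
  assumes "m \<ge> 2"
  shows "(\<Sum>l<m. f l) = f 0 + f 1 + (\<Sum>l\<in>{2..<m}. f l)"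
proof -
  have "{..<m} = insert 0 (insert 1 {2..<m})" using assms by auto
  then show ?thesis by (simp add: add.assoc)
qed

lemma Ker_face_eq_0:
  assumes chi: "chi \<in> char_maps (verts_J m J) (faces_PJ m J) n"
    and "c \<in> Ker (verts_J m J) chi" "\<sigma> \<in> faces_PJ m J" "\<forall>v. v \<notin> \<sigma> \<longrightarrow> c v = 0"
  shows "c = (\<lambda>v. 0)"
proof -
  have "\<rho> \<subseteq> verts_J m J" if "\<rho> \<in> faces_PJ m J" for \<rho>
    using that by (simp add: faces_PJ_def)
  from char_maps_iff_Ker[OF finite_verts_J this] chi
  have "\<forall>\<sigma>\<in>faces_PJ m J. \<forall>c\<in>Ker (verts_J m J) chi. (\<forall>v. v \<notin> \<sigma> \<longrightarrow> c v = 0) \<longrightarrow> c = (\<lambda>v. 0)"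
    by (rule iffD1[THEN conjunct2])
  with assms(2-4) show ?thesis by blast
qed

text \<open>The support of \<open>c\<close> itself is taken as the face.\<close>

lemma Ker_edge_eq_0:
  assumes m: "m \<ge> 3" and J: "\<forall>i<m. J i > 0"
    and chi: "chi \<in> char_maps (verts_J m J) (faces_PJ m J) n"
    and c: "c \<in> Ker (verts_J m J) chi" and i: "i < m"
    and zero: "\<And>j. j < m \<Longrightarrow> j \<noteq> i \<Longrightarrow> j \<noteq> Suc i mod m \<Longrightarrow> \<exists>k<J j. c (j, k) = 0"
  shows "c = (\<lambda>v. 0)"
proof -
  define \<sigma> where "\<sigma> = {v. c v = 1}"
  have "\<sigma> \<subseteq> verts_J m J"
  proof
    fix v assume "v \<in> \<sigma>"
    then have "c v \<noteq> 0" by (simp add: \<sigma>_def)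
    with c show "v \<in> verts_J m J" unfolding Ker_def by blast
  qed
  moreover have "\<exists>k<J j. (j, k) \<notin> \<sigma>" if "j < m" "j \<noteq> i" "j \<noteq> Suc i mod m" for j
  proof -
    from zero[OF that] obtain k where "k < J j" "c (j, k) = 0" by blast
    then show ?thesis by (intro exI[of _ k]) (simp add: \<sigma>_def)
  qed
  ultimately have "\<sigma> \<in> faces_PJ m J"
    unfolding faces_PJ_iff[OF m] using i by blast
  moreover have "\<forall>v. v \<notin> \<sigma> \<longrightarrow> c v = 0" by (simp add: \<sigma>_def)
  ultimately show ?thesis
    by (rule Ker_face_eq_0[OF chi c])
qed

text \<open>\<open>u j\<close> is the relation that expresses the vector of \<open>(j, 0)\<close>
  through the standard facet. A kernel vector minus the matching combination of the
  \<open>u j\<close> is supported on that facet, hence zero.\<close>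

lemma Ker_basis:
  assumes m: "m \<ge> 3" and J: "\<forall>i<m. J i > 0"
    and chi: "chi \<in> char_maps (verts_J m J) (faces_PJ m J) (card (E_index m J) + 2)"
  obtains u where "\<And>j. j \<in> {2..<m} \<Longrightarrow> u j \<in> Ker (verts_J m J) chi"
    "\<And>j l. j \<in> {2..<m} \<Longrightarrow> l \<in> {2..<m} \<Longrightarrow> u j (l, 0) = of_bool (l = j)"
    "\<And>c v. c \<in> Ker (verts_J m J) chi \<Longrightarrow> c v = (\<Sum>j\<in>{2..<m}. c (j, 0) * u j v)"
proof -
  let ?V = "verts_J m J" and ?\<sigma> = "std_facet m J"
  have sV: "?\<sigma> \<subseteq> ?V" by (auto simp: std_facet_def)
  have "\<exists>c\<in>Ker ?V chi. \<forall>l\<in>{2..<m}. c (l, 0) = of_bool (l = j)" if j: "j \<in> {2..<m}" for j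
  proof -
    have jV: "(j, 0) \<in> ?V" using j J by (simp add: verts_J_def)
    have zero: "chi (j, 0) i = 0" if "card (E_index m J) + 2 \<le> i" for i
      using chi that unfolding char_maps_def by blast
    obtain c where c: "\<And>v. v \<notin> ?\<sigma> \<Longrightarrow> c v = 0" "\<And>i. (\<Sum>v\<in>?\<sigma>. c v * chi v i) = chi (j, 0) i"
      using char_maps_spans[OF finite_verts_J std_facet_face[OF m J] sV card_std_facet[OF m J] chi,
          of "chi (j, 0)"] zero
      by blast
    have "(\<Sum>v\<in>?V. c v * chi v i) = (\<Sum>v\<in>?\<sigma>. c v * chi v i)" for i
      by (rule sum.mono_neutral_right) (use finite_verts_J sV c(1) in auto)
    moreover have "(\<Sum>v\<in>?V. of_bool (v = (j, 0)) * chi v i) = chi (j, 0) i" for i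
      using jV finite_verts_J by (simp add: of_bool_def if_distrib[of "\<lambda>x. x * _"] cong: if_cong)
    moreover have "of_bool (v = (j, 0)) + c v = 0" if "v \<notin> ?V" for v
    proof -
      have "c v = 0" using c(1) sV that by blast
      moreover have "v \<noteq> (j, 0)" using that jV by blast
      ultimately show ?thesis by simp
    qed
    ultimately have "(\<lambda>v. of_bool (v = (j, 0)) + c v) \<in> Ker ?V chi"
      unfolding Ker_def using c(2) by (simp only: mem_Collect_eq distrib_right sum.distrib) simp
    moreover have "c (l, 0) = 0" if "l \<in> {2..<m}" for l
      using c(1) that by (auto simp: std_facet_def)
    ultimately show ?thesis
      by (intro bexI[of _ "\<lambda>v. of_bool (v = (j, 0)) + c v"]) simp_all
  qed
  then have "\<forall>j\<in>{2..<m}. \<exists>c. c \<in> Ker ?V chi \<and> (\<forall>l\<in>{2..<m}. c (l, 0) = of_bool (l = j))" by blast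
  then obtain u where u: "\<forall>j\<in>{2..<m}. u j \<in> Ker ?V chi \<and> (\<forall>l\<in>{2..<m}. u j (l, 0) = of_bool (l = j))"
    by (rule bchoice[THEN exE])
  have "c v = (\<Sum>j\<in>{2..<m}. c (j, 0) * u j v)" if c: "c \<in> Ker ?V chi" for c v
  proof -
    let ?d = "\<lambda>v. c v + (\<Sum>j\<in>{2..<m}. c (j, 0) * u j v)"
    have d: "?d \<in> Ker ?V chi"
      using u by (intro Ker_add[OF c] Ker_combination) blast
    have "?d = (\<lambda>v. 0)"
    proof (rule Ker_edge_eq_0[OF m J chi d, of 0])
      fix l assume l: "l < m" "l \<noteq> 0" "l \<noteq> Suc 0 mod m"
      with m have l2: "l \<in> {2..<m}" by auto
      have "(\<Sum>j\<in>{2..<m}. c (j, 0) * u j (l, 0)) = (\<Sum>j\<in>{2..<m}. c (j, 0) * of_bool (l = j))"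
        using u l2 by (intro sum.cong) auto
      also have "\<dots> = c (l, 0)"
        using l2 by (simp add: of_bool_def if_distrib[of "\<lambda>x. _ * x"] cong: if_cong)
      finally show "\<exists>k<J l. c (l, k) + (\<Sum>j\<in>{2..<m}. c (j, 0) * u j (l, k)) = 0"
        using J l(1) by (intro exI[of _ 0]) simp
    qed (use m in simp)
    from fun_cong[OF this, of v] show ?thesis by simp
  qed
  with u that[of u] show ?thesis by blast
qed

lemma Ker_partition:
  assumes m: "m \<ge> 3" and J: "\<forall>i<m. J i > 0"
    and chi: "chi \<in> char_maps (verts_J m J) (faces_PJ m J) (card (E_index m J) + 2)"
  obtains \<Lambda> where "\<Lambda> \<in> DJ_P m"
    "\<And>x. balanced m \<Lambda> x \<longleftrightarrow> (\<exists>c\<in>Ker (verts_J m J) chi. \<forall>l<m. c (l, 0) = x l)"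
proof -
  let ?V = "verts_J m J"
  obtain u where u: "\<And>j. j \<in> {2..<m} \<Longrightarrow> u j \<in> Ker ?V chi"
    "\<And>j l. j \<in> {2..<m} \<Longrightarrow> l \<in> {2..<m} \<Longrightarrow> u j (l, 0) = of_bool (l = j)"
    "\<And>c v. c \<in> Ker ?V chi \<Longrightarrow> c v = (\<Sum>j\<in>{2..<m}. c (j, 0) * u j v)"
    using Ker_basis[OF m J chi] by blast
  \<comment> \<open>Column \<open>l\<close> of the two rows \<open>r 0\<close> and
    \<open>r 1\<close> is the vector of the polygon vertex \<open>l\<close> in the basis given by
    the vertices \<open>0\<close> and \<open>1\<close>; for \<open>2 \<le> l\<close> it is read off
    from the relation \<open>u l\<close>.\<close>
  define r where "r a l = (if l < 2 then of_bool (l = a) else u l (a, 0))" for a l :: nat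
  have r_sum: "(\<Sum>l<m. r a l * x l) = x a + (\<Sum>j\<in>{2..<m}. x j * u j (a, 0))" if "a < 2" for a x
  proof -
    have "(\<Sum>l\<in>{2..<m}. r a l * x l) = (\<Sum>j\<in>{2..<m}. x j * u j (a, 0))"
      by (rule sum.cong) (auto simp: r_def mult.commute)
    moreover have "r a 0 * x 0 + r a 1 * x 1 = x a"
      using that by (auto simp: r_def less_2_cases_iff)
    ultimately show ?thesis using sum_split_two[of m "\<lambda>l. r a l * x l"] m by simp
  qed
  define good where "good x \<longleftrightarrow> (\<Sum>l<m. r 0 l * x l) = 0 \<and> (\<Sum>l<m. r 1 l * x l) = 0" for x
  have good: "good x \<longleftrightarrow> (\<exists>c\<in>Ker ?V chi. \<forall>l<m. c (l, 0) = x l)" for x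
  proof
    assume "good x"
    then have x01: "x a = (\<Sum>j\<in>{2..<m}. x j * u j (a, 0))" if "a < 2" for a
      using r_sum[OF that, of x] that by (auto simp: good_def less_2_cases_iff)
    let ?c = "\<lambda>v. \<Sum>j\<in>{2..<m}. x j * u j v"
    have "?c (l, 0) = x l" if "l < m" for l
    proof (cases "l < 2")
      case False
      then have l2: "l \<in> {2..<m}" using that by simp
      then have "?c (l, 0) = (\<Sum>j\<in>{2..<m}. x j * of_bool (l = j))"
        using u(2) by (intro sum.cong) auto
      also have "\<dots> = x l"
        using l2 by (simp add: of_bool_def if_distrib[of "\<lambda>x. _ * x"] cong: if_cong)
      finally show ?thesis .
    qed (simp add: x01)
    moreover have "?c \<in> Ker ?V chi" using u(1) by (rule Ker_combination)
    ultimately show "\<exists>c\<in>Ker ?V chi. \<forall>l<m. c (l, 0) = x l" by (intro bexI[of _ ?c] allI impI)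
  next
    assume "\<exists>c\<in>Ker ?V chi. \<forall>l<m. c (l, 0) = x l"
    then obtain c where c: "c \<in> Ker ?V chi" "\<And>l. l < m \<Longrightarrow> c (l, 0) = x l" by blast
    have "x a = (\<Sum>j\<in>{2..<m}. x j * u j (a, 0))" if "a < 2" for a
    proof -
      have "x a = c (a, 0)" using c(2)[of a] that m by simp
      also have "\<dots> = (\<Sum>j\<in>{2..<m}. c (j, 0) * u j (a, 0))" by (rule u(3)[OF c(1)])
      also have "\<dots> = (\<Sum>j\<in>{2..<m}. x j * u j (a, 0))" using c(2) by (intro sum.cong) auto
      finally show ?thesis .
    qed
    then show "good x" using r_sum[of 0 x] r_sum[of 1 x] by (simp add: good_def)
  qed
  \<comment> \<open>A relation within one edge would lift to a kernel vector with zero base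
    coordinates off that edge. Singletons \<open>Y\<close> then show that no column is zero, pairs
    that adjacent columns differ.\<close>
  have edge: "\<not> good (\<lambda>l. of_bool (l \<in> Y))" if Y: "Y \<subseteq> {i, Suc i mod m}" "i < m" "Y \<noteq> {}" for Y i
  proof
    assume "good (\<lambda>l. of_bool (l \<in> Y))"
    then obtain c where c: "c \<in> Ker ?V chi" "\<forall>l<m. c (l, 0) = of_bool (l \<in> Y)"
      unfolding good by blast
    have "c = (\<lambda>v. 0)"
    proof (rule Ker_edge_eq_0[OF m J chi c(1) Y(2)])
      fix j assume j: "j < m" "j \<noteq> i" "j \<noteq> Suc i mod m"
      then have "j \<notin> Y" using Y(1) by blast
      with c(2) j(1) J show "\<exists>k<J j. c (j, k) = 0" by (intro exI[of _ 0]) simp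
    qed
    moreover obtain l where "l \<in> Y" using Y(3) by blast
    moreover have "l < m" using \<open>l \<in> Y\<close> Y(1,2) by auto
    ultimately show False using c(2) by auto
  qed
  have good_ind: "good (\<lambda>l. of_bool (l \<in> Y)) \<longleftrightarrow> (\<Sum>l\<in>Y. r 0 l) = 0 \<and> (\<Sum>l\<in>Y. r 1 l) = 0"
    if "Y \<subseteq> {..<m}" for Y
    unfolding good_def sum_of_bool_mult[OF that] ..
  have nz: "r 0 l = 1 \<or> r 1 l = 1" if "l < m" for l
    using edge[of "{l}" l] good_ind[of "{l}"] that by auto
  have adj: "r 0 l \<noteq> r 0 (Suc l mod m) \<or> r 1 l \<noteq> r 1 (Suc l mod m)" if "l < m" for l
  proof -
    have "l \<noteq> Suc l mod m" using that m by (cases "Suc l = m") auto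
    with edge[of "{l, Suc l mod m}" l] good_ind[of "{l, Suc l mod m}"] that show ?thesis by auto
  qed
  define part where "part a b = {l. l < m \<and> r 0 l = a \<and> r 1 l = b}" for a b
  define \<Lambda> where "\<Lambda> = {part 1 0, part 0 1, part 1 1}"
  \<comment> \<open>Two parts are visibly inhabited, so even if \<open>part 1 1\<close> is empty the
    three sets are distinct.\<close>
  have "0 \<in> part 1 0" "1 \<in> part 0 1" using m by (simp_all add: part_def r_def)
  moreover have "0 \<notin> part 0 1" "0 \<notin> part 1 1" "1 \<notin> part 1 1" by (simp_all add: part_def r_def)
  ultimately have "part 1 0 \<noteq> part 0 1" "part 1 0 \<noteq> part 1 1" "part 0 1 \<noteq> part 1 1"
    by metis+
  then have "card \<Lambda> = 3" by (simp add: \<Lambda>_def)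
  moreover have "\<Union>\<Lambda> = {0..<m}"
  proof
    show "{0..<m} \<subseteq> \<Union>\<Lambda>"
    proof
      fix l assume "l \<in> {0..<m}"
      with nz[of l] show "l \<in> \<Union>\<Lambda>"
        by (cases "r 0 l"; cases "r 1 l") (auto simp: \<Lambda>_def part_def)
    qed
  qed (auto simp: \<Lambda>_def part_def)
  moreover have "\<forall>A\<in>\<Lambda>. \<forall>B\<in>\<Lambda>. A \<noteq> B \<longrightarrow> A \<inter> B = {}"
    by (auto simp: \<Lambda>_def part_def)
  moreover have "nonconsec m (part a b)" for a b
    unfolding nonconsec_def
  proof (intro allI impI notI)
    fix l assume "l < m" "{l, Suc l mod m} \<subseteq> part a b"
    with adj[of l] show False by (simp add: part_def)
  qed
  then have "\<forall>A\<in>\<Lambda>. nonconsec m A" by (simp add: \<Lambda>_def)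
  ultimately have "\<Lambda> \<in> DJ_P m" by (simp add: DJ_P_def)
  moreover have "balanced m \<Lambda> x \<longleftrightarrow> good x" for x
  proof -
    have nz0: "r 0 l = 1" if "l < m" "r (Suc 0) l = 0" for l using nz[OF that(1)] that(2) by simp
    have nz1: "r (Suc 0) l = 1" if "l < m" "r 0 l = 0" for l using nz[OF that(1)] that(2) by simp
    \<comment> \<open>As no column is zero, the complement of \<open>part 1 0\<close> is where the
      row \<open>r 1\<close> equals \<open>1\<close>; similarly for the other two parts with
      \<open>r 0\<close> and \<open>r 0 + r 1\<close>.\<close>
    have "(\<Sum>l\<in>{..<m} - part 1 0. x l) = (\<Sum>l<m. r 1 l * x l)"
      by (rule sum.mono_neutral_cong_left) (auto simp: part_def nz0 nz1)
    moreover have "(\<Sum>l\<in>{..<m} - part 0 1. x l) = (\<Sum>l<m. r 0 l * x l)"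
      by (rule sum.mono_neutral_cong_left) (auto simp: part_def nz0 nz1)
    moreover have "(\<Sum>l\<in>{..<m} - part 1 1. x l) = (\<Sum>l<m. (r 0 l + r 1 l) * x l)"
    proof (rule sum.mono_neutral_cong_left)
      fix l assume "l \<in> {..<m} - part 1 1"
      with nz[of l] have "r 0 l + r 1 l = 1" by (auto simp: part_def)
      then show "x l = (r 0 l + r 1 l) * x l" by (simp only: mult_1)
    qed (auto simp: part_def)
    ultimately show ?thesis
      by (auto simp: balanced_def \<Lambda>_def good_def distrib_right sum.distrib)
  qed
  then have "balanced m \<Lambda> x \<longleftrightarrow> (\<exists>c\<in>Ker ?V chi. \<forall>l<m. c (l, 0) = x l)" for x
    unfolding good .
  ultimately show ?thesis by (rule that)
qed

text \<open>The coordinate \<open>c (p, k + 1)\<close> of a kernel vector is \<open>c (p, 0) + \<Sum> D l * c (l, 0)\<close>, where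
  \<open>D\<close> vanishes on the part of \<open>p\<close> and is constant on the arcs between points of that part;
  \<open>S\<close> consists of the points across which \<open>D\<close> changes.\<close>

lemma Ker_eset:
  assumes m: "m \<ge> 3" and J: "\<forall>i<m. J i > 0"
    and chi: "chi \<in> char_maps (verts_J m J) (faces_PJ m J) (card (E_index m J) + 2)"
    and L: "\<Lambda> \<in> DJ_P m"
    and bal: "\<And>x. balanced m \<Lambda> x \<longleftrightarrow> (\<exists>c\<in>Ker (verts_J m J) chi. \<forall>l<m. c (l, 0) = x l)"
    and pk: "(p, k) \<in> E_index m J"
  obtains S where "eset_compat m \<Lambda> p S"
    "\<And>c. c \<in> Ker (verts_J m J) chi \<Longrightarrow> c (p, Suc k) = c (p, 0) + twist m \<Lambda> p S (\<lambda>l. c (l, 0))"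
proof -
  let ?U = "Ker (verts_J m J) chi"
  have p: "p < m" "Suc k < J p" using pk by (auto simp: E_index_def)
  have balU: "balanced m \<Lambda> (\<lambda>l. c (l, 0))" if "c \<in> ?U" for c
    using that bal by blast
  obtain u where u: "\<And>c v. c \<in> ?U \<Longrightarrow> c v = (\<Sum>j\<in>{2..<m}. c (j, 0) * u j v)"
    using Ker_basis[OF m J chi] by metis
  define d where "d l = of_bool (l = p) + (if l < 2 then 0 else u l (p, Suc k))" for l
  obtain A where A: "A \<in> \<Lambda>" "Suc p mod m \<in> A"
    using DJ_P_part[OF L, of "Suc p mod m"] p(1) by auto
  have pA: "p \<notin> A"
    using not_lam_equiv_Suc[OF L p(1)] A by (auto simp: lam_equiv_def)
  \<comment> \<open>The coefficients \<open>d\<close> matter only up to functionals that vanish on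
    balanced vectors. The one of the part \<open>A\<close> next to \<open>p\<close> has coefficient
    \<open>1\<close> at \<open>p\<close>, so adding a multiple of it normalises the coefficient at
    \<open>p\<close> to zero.\<close>
  define D where "D l = d l + d p * of_bool (l \<notin> A)" for l
  have Dp: "D p = 0" using pA by (simp add: D_def)
  have D: "c (p, Suc k) = c (p, 0) + (\<Sum>l<m. D l * c (l, 0))" if c: "c \<in> ?U" for c
  proof -
    have "(\<Sum>l<m. of_bool (l \<notin> A) * c (l, 0)) = (\<Sum>l\<in>{..<m} - A. c (l, 0))"
      by (rule sum.mono_neutral_cong_right) auto
    also have "\<dots> = 0" using balU[OF c] A(1) by (simp add: balanced_def)
    finally have "(\<Sum>l<m. D l * c (l, 0)) = (\<Sum>l<m. d l * c (l, 0))"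
      by (simp add: D_def distrib_right sum.distrib mult.assoc flip: sum_distrib_left)
    also have "\<dots> = (\<Sum>l<m. c (l, 0) * of_bool (l \<in> {p})) + (\<Sum>l<m. (if l < 2 then 0 else u l (p, Suc k)) * c (l, 0))"
      unfolding sum.distrib[symmetric] by (rule sum.cong) (simp_all add: d_def algebra_simps)
    also have "(\<Sum>l<m. c (l, 0) * of_bool (l \<in> {p})) = c (p, 0)"
      by (subst sum_of_bool_mult) (use p in auto)
    also have "(\<Sum>l<m. (if l < 2 then 0 else u l (p, Suc k)) * c (l, 0)) =
        (\<Sum>l\<in>{2..<m}. c (l, 0) * u l (p, Suc k))"
      by (rule sum.mono_neutral_cong_right) (auto simp: mult.commute)
    also have "\<dots> = c (p, Suc k)" by (rule u[OF c, symmetric])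
    finally show ?thesis by simp
  qed
  \<comment> \<open>If the sum were \<open>1\<close>, it would cancel the base coordinate
    \<open>c (p, 0) = 1\<close>, and the support of \<open>c\<close> would be a face missing
    \<open>(p, Suc k)\<close>. Pairs \<open>Y\<close> give \<open>D = 0\<close> on the part of
    \<open>p\<close>, triples give that \<open>D\<close> is constant along arcs.\<close>
  have D_edge: "(\<Sum>l\<in>Y. D l) = 0"
    if Y: "p \<in> Y" "i < m" "Y \<subseteq> {p, i, Suc i mod m}" "balanced m \<Lambda> (\<lambda>l. of_bool (l \<in> Y))" for Y i
  proof (rule ccontr)
    assume "(\<Sum>l\<in>Y. D l) \<noteq> 0"
    then have sum1: "(\<Sum>l\<in>Y. D l) = 1" by simp
    have Ym: "Y \<subseteq> {..<m}" using Y(2,3) p(1) by auto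
    from Y(4) obtain c where c: "c \<in> ?U" "\<forall>l<m. c (l, 0) = of_bool (l \<in> Y)" unfolding bal by blast
    have "(\<Sum>l<m. D l * c (l, 0)) = (\<Sum>l<m. D l * of_bool (l \<in> Y))"
      using c(2) by (intro sum.cong) auto
    then have cp: "c (p, Suc k) = 0"
      using D[OF c(1)] sum1 c(2) p(1) Y(1) by (simp add: sum_of_bool_mult[OF Ym])
    have "c = (\<lambda>v. 0)"
    proof (rule Ker_edge_eq_0[OF m J chi c(1) Y(2)])
      fix j assume j: "j < m" "j \<noteq> i" "j \<noteq> Suc i mod m"
      show "\<exists>k<J j. c (j, k) = 0"
      proof (cases "j = p")
        case True with cp p(2) show ?thesis by blast
      next
        case False
        then have "j \<notin> Y" using Y(3) j by blast
        with c(2) j(1) J show ?thesis by (intro exI[of _ 0]) simp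
      qed
    qed
    with c(2) p(1) Y(1) show False by auto
  qed
  have D_part: "D l = 0" if l: "l < m" "lam_equiv \<Lambda> p l" for l
  proof (cases "l = p")
    case False
    then have "p \<noteq> l" by simp
    with D_edge[of "{p, l}" l] balanced_pair[OF L p(1) l(1) _ l(2)] l(1) Dp show ?thesis by auto
  qed (simp add: Dp)
  have D_adj: "D (Suc l mod m) = D l"
    if l: "l < m" "\<not> lam_equiv \<Lambda> p l" "\<not> lam_equiv \<Lambda> p (Suc l mod m)" for l
  proof -
    have sm: "Suc l mod m < m" using l(1) by simp
    have "l \<noteq> Suc l mod m" using l(1) m by (cases "Suc l = m") auto
    moreover have "p \<noteq> l" "p \<noteq> Suc l mod m" using l(2,3) lam_equiv_refl[OF L p(1)] by auto
    moreover have "(\<Sum>l\<in>{p, l, Suc l mod m}. D l) = 0"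
      using D_edge[of "{p, l, Suc l mod m}" l] l(1)
        balanced_triple[OF L p(1) l(1) sm l(2,3) not_lam_equiv_Suc[OF L l(1)]] by simp
    ultimately show ?thesis using Dp by simp
  qed
  \<comment> \<open>At a point of the part of \<open>p\<close>, where \<open>D\<close> is zero,
    \<open>H\<close> takes the value of \<open>D\<close> on the arc just before it; so
    \<open>H\<close> jumps from \<open>s\<close> to \<open>Suc s\<close> exactly where
    \<open>D\<close> changes across \<open>s\<close>. The reductions modulo \<open>m\<close> are
    there because \<open>H\<close> is also evaluated at \<open>m\<close>.\<close>
  define H where "H h = (if lam_equiv \<Lambda> p (h mod m) then D ((h + m - 1) mod m) else D (h mod m))" for h
  have H_eq: "H l = D l" if "l < m" "\<not> lam_equiv \<Lambda> p l" for l
    using that by (simp add: H_def)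
  have H_Suc: "H (Suc l) = H l" if l: "l < m" "\<not> lam_equiv \<Lambda> p l" for l
    unfolding H_eq[OF l] using D_adj[OF l] l(1) by (simp add: H_def)
  have "m + m - 1 = m - 1 + m" using m by simp
  then have "(m + m - 1) mod m = m - 1" using m by (simp only: mod_add_self2) simp
  then have Hm: "H m = H 0"
    using m by (simp add: H_def)
  define S where "S = {s. s < m \<and> H s \<noteq> H (Suc s)}"
  have side_S: "side S h = H 0 + H h" if "h \<le> m" for h
    \<comment> \<open>The jumps of \<open>H\<close> telescope. As \<open>H m = H 0\<close>, their
      number is even.\<close>
    using that
  proof (induction h)
    case (Suc h)
    then have "side S (Suc h) = H 0 + H h + of_bool (H h \<noteq> H (Suc h))"
      by (simp add: side_Suc S_def)
    then show ?case by (cases "H 0"; cases "H h"; cases "H (Suc h)") simp_all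
  qed simp
  have equiv: "lam_equiv \<Lambda> p s" if "s \<in> S" for s
    using that H_Suc unfolding S_def by (metis (mono_tags, lifting) mem_Collect_eq)
  have "side S m = 0" using side_S[of m] Hm by simp
  moreover have S_sub: "S \<subseteq> {0..<m}" by (auto simp: S_def)
  ultimately have "even (card S)" using side_full by blast
  moreover have "lam_equiv \<Lambda> x y" if "x \<in> insert p S" "y \<in> insert p S" for x y
    using that equiv lam_equiv_refl[OF L p(1)] lam_equiv_trans[OF L] lam_equiv_sym by blast
  ultimately have compat: "eset_compat m \<Lambda> p S"
    using p(1) S_sub by (simp add: eset_compat_def)
  have "c (p, Suc k) = c (p, 0) + twist m \<Lambda> p S (\<lambda>l. c (l, 0))" if c: "c \<in> ?U" for c
  proof -
    have "twist m \<Lambda> p S (\<lambda>l. c (l, 0)) =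
        (\<Sum>l | l < m \<and> \<not> lam_equiv \<Lambda> p l. (side S l + H 0) * c (l, 0))"
      by (rule twist_shift[OF L balU[OF c] p(1)])
    also have "\<dots> = (\<Sum>l | l < m \<and> \<not> lam_equiv \<Lambda> p l. D l * c (l, 0))"
      using side_S H_eq by (intro sum.cong) (auto simp: add.commute)
    also have "\<dots> = (\<Sum>l<m. D l * c (l, 0))"
      by (rule sum.mono_neutral_left) (use D_part in auto)
    finally show ?thesis using D[OF c] by simp
  qed
  with compat show ?thesis by (rule that)
qed

lemma Ker_eq_DJ_kernel:
  assumes m: "m \<ge> 3" and J: "\<forall>i<m. J i > 0"
    and chi: "chi \<in> char_maps (verts_J m J) (faces_PJ m J) (card (E_index m J) + 2)"
  obtains \<Lambda> E where "(\<Lambda>, E) \<in> DJ_mJ m J" "Ker (verts_J m J) chi = DJ_kernel m J \<Lambda> E"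
proof -
  let ?U = "Ker (verts_J m J) chi"
  obtain \<Lambda> where L: "\<Lambda> \<in> DJ_P m"
      and bal: "\<And>x. balanced m \<Lambda> x \<longleftrightarrow> (\<exists>c\<in>?U. \<forall>l<m. c (l, 0) = x l)"
    using Ker_partition[OF m J chi] by blast
  have "\<forall>e\<in>E_index m J. \<exists>S. eset_compat m \<Lambda> (fst e) S \<and>
      (\<forall>c\<in>?U. c (fst e, Suc (snd e)) = c (fst e, 0) + twist m \<Lambda> (fst e) S (\<lambda>l. c (l, 0)))"
  proof
    fix e assume e: "e \<in> E_index m J"
    then have "(fst e, snd e) \<in> E_index m J" by simp
    from Ker_eset[OF m J chi L bal this] obtain S where "eset_compat m \<Lambda> (fst e) S"
      "\<And>c. c \<in> ?U \<Longrightarrow> c (fst e, Suc (snd e)) = c (fst e, 0) + twist m \<Lambda> (fst e) S (\<lambda>l. c (l, 0))"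
      by blast
    then show "\<exists>S. eset_compat m \<Lambda> (fst e) S \<and>
      (\<forall>c\<in>?U. c (fst e, Suc (snd e)) = c (fst e, 0) + twist m \<Lambda> (fst e) S (\<lambda>l. c (l, 0)))" by blast
  qed
  then obtain F where F: "\<forall>e\<in>E_index m J. eset_compat m \<Lambda> (fst e) (F e) \<and>
      (\<forall>c\<in>?U. c (fst e, Suc (snd e)) = c (fst e, 0) + twist m \<Lambda> (fst e) (F e) (\<lambda>l. c (l, 0)))"
    by (rule bchoice[THEN exE])
  define E where "E e = (if e \<in> E_index m J then F e else {})" for e
  have compat: "eset_compat m \<Lambda> p (E (p, k))" if "(p, k) \<in> E_index m J" for p k
    using F[rule_format, OF that] that by (simp add: E_def)
  have sub: "?U \<subseteq> DJ_kernel m J \<Lambda> E"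
  proof
    fix c assume c: "c \<in> ?U"
    have "c (p, Suc k) = c (p, 0) + twist m \<Lambda> p (E (p, k)) (\<lambda>l. c (l, 0))"
      if "(p, k) \<in> E_index m J" for p k
      using F[rule_format, OF that] c that by (simp add: E_def)
    moreover have "balanced m \<Lambda> (\<lambda>l. c (l, 0))" using c bal by blast
    moreover have "\<forall>v. v \<notin> verts_J m J \<longrightarrow> c v = 0" using c unfolding Ker_def by blast
    ultimately show "c \<in> DJ_kernel m J \<Lambda> E" unfolding DJ_kernel_def by blast
  qed
  \<comment> \<open>Both spaces restrict to the base vertices with image all balanced vectors, and
    the restriction is injective on the larger one, so the inclusion is an equality.\<close>
  have eq: "?U = DJ_kernel m J \<Lambda> E"
  proof (rule equalityI[OF sub subsetI])
    fix c assume c: "c \<in> DJ_kernel m J \<Lambda> E"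
    then have "balanced m \<Lambda> (\<lambda>l. c (l, 0))" by (simp add: DJ_kernel_def)
    then obtain d where d: "d \<in> ?U" "\<And>l. l < m \<Longrightarrow> d (l, 0) = c (l, 0)"
      unfolding bal by blast
    have "d = c" using DJ_kernel_unique[OF J subsetD[OF sub d(1)] c d(2)] .
    with d(1) show "c \<in> ?U" by simp
  qed
  have faces: "c = (\<lambda>v. 0)"
    if "c \<in> DJ_kernel m J \<Lambda> E" "\<sigma> \<in> faces_PJ m J" "\<forall>v. v \<notin> \<sigma> \<longrightarrow> c v = 0" for c \<sigma>
    by (rule Ker_face_eq_0[OF chi]) (use that in \<open>simp_all add: eq\<close>)
  have rel: "lam_related m \<Lambda> (p, E (p, k)) (q, E (q, l))"
    if "(p, k) \<in> E_index m J" "(q, l) \<in> E_index m J" for p k q l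
    by (rule related_if_DJ_kernel_face_eq_0[OF m J L compat faces that])
  have "lam_related m \<Lambda> (fst x, E x) (fst y, E y)" if "x \<in> E_index m J" "y \<in> E_index m J" for x y
    using rel[of "fst x" "snd x" "fst y" "snd y"] that by simp
  moreover have "eset_compat m \<Lambda> (fst x) (E x)" if "x \<in> E_index m J" for x
    using compat[of "fst x" "snd x"] that by simp
  ultimately have "(\<Lambda>, E) \<in> DJ_mJ m J"
    using L by (simp add: DJ_mJ_def E_def)
  with eq show ?thesis using that by blast
qed

theorem mainTheorem7:
  fixes m :: nat and J :: "nat \<Rightarrow> nat"
  assumes "m \<ge> 3" and "\<forall>i<m. J i > 0"
  shows "\<exists>f. bij_betw f (DJ_classes_PJ m J) (DJ_mJ m J)"
proof -
  let ?V = "verts_J m J" and ?K = "faces_PJ m J"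
  define n where "n = card (E_index m J) + 2"
  define CM where "CM = char_maps ?V ?K n"
  have sV: "std_facet m J \<subseteq> ?V" by (auto simp: std_facet_def)
  have rel: "DJ_rel ?V ?K n = {(chi, chi'). chi \<in> CM \<and> chi' \<in> CM \<and> Ker ?V chi = Ker ?V chi'}"
    using DJ_rel_iff[OF finite_verts_J std_facet_face[OF assms] sV card_std_facet[OF assms]]
    by (auto simp: CM_def n_def)
  have "DJ_classes_PJ m J = CM // {(chi, chi'). chi \<in> CM \<and> chi' \<in> CM \<and> Ker ?V chi = Ker ?V chi'}"
    unfolding DJ_classes_PJ_def Let_def dimp1_faces_PJ[OF assms] n_def[symmetric] rel
    unfolding CM_def ..
  \<comment> \<open>The two sides are matched through the set of all kernels of characteristic
    maps.\<close>
  then have b1: "bij_betw (\<lambda>C. the_elem (Ker ?V ` C)) (DJ_classes_PJ m J) (Ker ?V ` CM)"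
    using quotient_bij_image[of "Ker ?V" CM] by simp
  have b2: "bij_betw (\<lambda>(\<Lambda>, E). DJ_kernel m J \<Lambda> E) (DJ_mJ m J) (Ker ?V ` CM)"
    unfolding bij_betw_def
  proof
    show "inj_on (\<lambda>(\<Lambda>, E). DJ_kernel m J \<Lambda> E) (DJ_mJ m J)"
      by (rule inj_onI) (use DJ_kernel_inj[OF assms] in \<open>clarsimp; blast\<close>)
    show "(\<lambda>(\<Lambda>, E). DJ_kernel m J \<Lambda> E) ` DJ_mJ m J = Ker ?V ` CM"
    proof (intro equalityI subsetI)
      fix U assume "U \<in> (\<lambda>(\<Lambda>, E). DJ_kernel m J \<Lambda> E) ` DJ_mJ m J"
      then obtain \<Lambda> E where E: "(\<Lambda>, E) \<in> DJ_mJ m J" "U = DJ_kernel m J \<Lambda> E" by auto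
      obtain chi where "chi \<in> CM" "Ker ?V chi = DJ_kernel m J \<Lambda> E"
        using DJ_kernel_realised[OF assms E(1)] unfolding CM_def n_def by blast
      with E(2) show "U \<in> Ker ?V ` CM" by (metis imageI)
    next
      fix U assume "U \<in> Ker ?V ` CM"
      then obtain chi where chi: "chi \<in> CM" "U = Ker ?V chi" by blast
      obtain \<Lambda> E where E: "(\<Lambda>, E) \<in> DJ_mJ m J" "Ker ?V chi = DJ_kernel m J \<Lambda> E"
        using Ker_eq_DJ_kernel[OF assms] chi(1) unfolding CM_def n_def by blast
      show "U \<in> (\<lambda>(\<Lambda>, E). DJ_kernel m J \<Lambda> E) ` DJ_mJ m J"
        by (rule image_eqI[OF _ E(1)]) (simp add: chi(2) E(2))
    qed
  qed
  show ?thesis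
    using bij_betw_trans[OF b1 bij_betw_inv_into[OF b2]] by blast
qed

end
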